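(* Let $K$ be a field, $n\ge1$, and let $\mathbb{S}_n$ be the algebra of one-sided inverses. Then ${}'\mathcal{C}_{\mathbb{S}_n}={}'S(\mathbb{S}_n)$ and ${}'Q_{l,cl}(\mathbb{S}_n)={}'Q(\mathbb{S}_n)\simeq K(y_1,\ldots,y_n)$, the field of rational functions in $n$ variables.
   Context: All rings are unital. A subset $S$ of a ring $R$ is multiplicative if $1\in S$, $SS\subseteq S$, $0\notin S$. A multiplicative set $S$ is a left Ore set if $Sr\cap Rs\neq\emptyset$ for all $r\in R$, $s\in S$. A left Ore set $S$ is a left denominator set if $rs=0$ with $r\in R$, $s\in S$ implies $tr=0$ for some $t\in S$; $S^{-1}R$ is the corresponding left localization. ${}'\mathcal{C}_R=\{c\in R\mid rc=0\Rightarrow r=0\}$ is the set of left regular elements of $R$. It contains a largest (with respect to inclusion) left denominator set of $R$, denoted ${}'S(R)$, and ${}'Q(R):={}'S(R)^{-1}R$ is the left regular left quotient ring of $R$. If ${}'\mathcal{C}_R$ is itself a left denominator set, then ${}'Q_{l,cl}(R):={}'\mathcal{C}_R^{-1}R$ is the classical left regular left quotient ring; a statement about ${}'Q_{l,cl}(R)$ includes the assertion that it exists. The symbol $\simeq$ denotes isomorphism of $K$-algebras. $\mathbb{S}_n$ is the $K$-algebra generated by $x_1,\ldots,x_n,y_1,\ldots,y_n$ subject to the relations $y_ix_i=1$ for all $i$ and $[x_i,y_j]=[x_i,x_j]=[y_i,y_j]=0$ for all $i\ne j$. *)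

theory Defs
  imports
    "HOL-Algebra.Algebraic_Closure_Type"
    "HOL-Library.Poly_Mapping"
    "HOL-Computational_Algebra.Fraction_Field"
begin

section \<open>Left denominator sets and left localizations\<close>

definition multiplicative_set :: "('a, 'm) ring_scheme \<Rightarrow> 'a set \<Rightarrow> bool" where
  "multiplicative_set R S \<longleftrightarrow>
     S \<subseteq> carrier R \<and> \<one>\<^bsub>R\<^esub> \<in> S \<and> (\<forall>s\<in>S. \<forall>t\<in>S. s \<otimes>\<^bsub>R\<^esub> t \<in> S) \<and> \<zero>\<^bsub>R\<^esub> \<notin> S"

definition left_Ore_set :: "('a, 'm) ring_scheme \<Rightarrow> 'a set \<Rightarrow> bool" where
  "left_Ore_set R S \<longleftrightarrow> multiplicative_set R S \<and>
     (\<forall>r\<in>carrier R. \<forall>s\<in>S. (\<lambda>t. t \<otimes>\<^bsub>R\<^esub> r) ` S \<inter> (\<lambda>a. a \<otimes>\<^bsub>R\<^esub> s) ` carrier R \<noteq> {})"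

definition left_denominator_set :: "('a, 'm) ring_scheme \<Rightarrow> 'a set \<Rightarrow> bool" where
  "left_denominator_set R S \<longleftrightarrow> left_Ore_set R S \<and>
     (\<forall>r\<in>carrier R. \<forall>s\<in>S. r \<otimes>\<^bsub>R\<^esub> s = \<zero>\<^bsub>R\<^esub> \<longrightarrow> (\<exists>t\<in>S. t \<otimes>\<^bsub>R\<^esub> r = \<zero>\<^bsub>R\<^esub>))"

text \<open>
  A left fraction \<open>s\<inverse>r\<close> is the class of \<open>(s, r)\<close>, two pairs being identified if they
  become equal after passing to a common denominator in \<open>S\<close>.
\<close>

definition left_frac_rel :: "('a, 'm) ring_scheme \<Rightarrow> 'a set \<Rightarrow> (('a \<times> 'a) \<times> ('a \<times> 'a)) set" where
  "left_frac_rel R S = {((s, r), (s', r')). s \<in> S \<and> r \<in> carrier R \<and> s' \<in> S \<and> r' \<in> carrier R \<and>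
     (\<exists>a\<in>carrier R. \<exists>b\<in>carrier R.
        a \<otimes>\<^bsub>R\<^esub> s = b \<otimes>\<^bsub>R\<^esub> s' \<and> a \<otimes>\<^bsub>R\<^esub> s \<in> S \<and> a \<otimes>\<^bsub>R\<^esub> r = b \<otimes>\<^bsub>R\<^esub> r')}"

definition left_frac :: "('a, 'm) ring_scheme \<Rightarrow> 'a set \<Rightarrow> 'a \<Rightarrow> 'a \<Rightarrow> ('a \<times> 'a) set" where
  "left_frac R S s r = left_frac_rel R S `` {(s, r)}"

text \<open>
  Localization of an algebra \<open>R\<close>. The operations are
  \<open>(s\<inverse>r) (t\<inverse>q) = (us)\<inverse>(aq)\<close> for \<open>ur = at\<close>, \<open>u \<in> S\<close>,
  \<open>s\<inverse>r + t\<inverse>q = (as)\<inverse>(ar + bq)\<close> for \<open>as = bt \<in> S\<close>, and \<open>k(s\<inverse>r) = s\<inverse>(kr)\<close> for scalars \<open>k\<close>.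
  If \<open>S\<close> is a left denominator set, the fractions on the right do not depend on the choices made,
  so that each union below is a union of copies of a single class; for other \<open>S\<close> the
  definition has no meaning.
\<close>

definition left_localization ::
    "('k, 'a, 'm) module_scheme \<Rightarrow> 'a set \<Rightarrow> ('k, ('a \<times> 'a) set) module" where
  "left_localization R S =
     \<lparr>carrier = (S \<times> carrier R) // left_frac_rel R S,
      monoid.mult = (\<lambda>P Q. \<Union>{left_frac R S (u \<otimes>\<^bsub>R\<^esub> s) (a \<otimes>\<^bsub>R\<^esub> q) | s r t q u a.
        (s, r) \<in> P \<and> (t, q) \<in> Q \<and> u \<in> S \<and> a \<in> carrier R \<and> u \<otimes>\<^bsub>R\<^esub> r = a \<otimes>\<^bsub>R\<^esub> t}),
      one = left_frac R S \<one>\<^bsub>R\<^esub> \<one>\<^bsub>R\<^esub>,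
      ring.zero = left_frac R S \<one>\<^bsub>R\<^esub> \<zero>\<^bsub>R\<^esub>,
      add = (\<lambda>P Q. \<Union>{left_frac R S (a \<otimes>\<^bsub>R\<^esub> s) ((a \<otimes>\<^bsub>R\<^esub> r) \<oplus>\<^bsub>R\<^esub> (b \<otimes>\<^bsub>R\<^esub> q)) | s r t q a b.
        (s, r) \<in> P \<and> (t, q) \<in> Q \<and> a \<in> carrier R \<and> b \<in> carrier R \<and>
        a \<otimes>\<^bsub>R\<^esub> s = b \<otimes>\<^bsub>R\<^esub> t \<and> a \<otimes>\<^bsub>R\<^esub> s \<in> S}),
      module.smult = (\<lambda>k P. \<Union>{left_frac R S s (k \<odot>\<^bsub>R\<^esub> r) | s r. (s, r) \<in> P})\<rparr>"

definition left_regular_elements :: "('a, 'm) ring_scheme \<Rightarrow> 'a set" where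
  "left_regular_elements R =
     {c \<in> carrier R. \<forall>r\<in>carrier R. r \<otimes>\<^bsub>R\<^esub> c = \<zero>\<^bsub>R\<^esub> \<longrightarrow> r = \<zero>\<^bsub>R\<^esub>}"

definition largest_left_regular_denominator_set :: "('a, 'm) ring_scheme \<Rightarrow> 'a set" where
  "largest_left_regular_denominator_set R =
     (GREATEST S. left_denominator_set R S \<and> S \<subseteq> left_regular_elements R)"

definition left_regular_left_quotient_ring ::
    "('k, 'a, 'm) module_scheme \<Rightarrow> ('k, ('a \<times> 'a) set) module" where
  "left_regular_left_quotient_ring R =
     left_localization R (largest_left_regular_denominator_set R)"

text \<open>Meaningful only if \<open>left_denominator_set R (left_regular_elements R)\<close>.\<close>

definition classical_left_regular_left_quotient_ring ::
    "('k, 'a, 'm) module_scheme \<Rightarrow> ('k, ('a \<times> 'a) set) module" where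
  "classical_left_regular_left_quotient_ring R = left_localization R (left_regular_elements R)"

definition algebra_isomorphic ::
    "('k, 'a, 'm) module_scheme \<Rightarrow> ('k, 'b, 'l) module_scheme \<Rightarrow> bool" where
  "algebra_isomorphic A B \<longleftrightarrow>
     (\<exists>h\<in>ring_iso A B. \<forall>k. \<forall>a\<in>carrier A. h (k \<odot>\<^bsub>A\<^esub> a) = k \<odot>\<^bsub>B\<^esub> h a)"


section \<open>The algebra of one-sided inverses\<close>

datatype generator = gen_x nat | gen_y nat

text \<open>
  Words in the generators, a free monoid written additively so that
  \<open>gen_word \<Rightarrow>\<^sub>0 'k\<close> with its convolution product is the free algebra on all generators.
\<close>

datatype gen_word = Word (letters: "generator list")

instantiation gen_word :: monoid_add
begin

definition zero_gen_word :: gen_word where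
  "0 = Word []"

definition plus_gen_word :: "gen_word \<Rightarrow> gen_word \<Rightarrow> gen_word" where
  "v + w = Word (letters v @ letters w)"

instance
  by standard (simp_all add: zero_gen_word_def plus_gen_word_def)

end

definition free_algebra :: "nat \<Rightarrow> (gen_word \<Rightarrow>\<^sub>0 'k::field) ring" where
  "free_algebra n = ring_of_type_algebra
     \<lparr>carrier := {p. \<forall>w\<in>Poly_Mapping.keys p. set (letters w) \<subseteq> gen_x ` {1..n} \<union> gen_y ` {1..n}}\<rparr>"

definition x_free :: "nat \<Rightarrow> gen_word \<Rightarrow>\<^sub>0 'k::field" where
  "x_free i = Poly_Mapping.single (Word [gen_x i]) 1"

definition y_free :: "nat \<Rightarrow> gen_word \<Rightarrow>\<^sub>0 'k::field" where
  "y_free i = Poly_Mapping.single (Word [gen_y i]) 1"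

definition one_sided_inverse_relators :: "nat \<Rightarrow> (gen_word \<Rightarrow>\<^sub>0 'k::field) set" where
  "one_sided_inverse_relators n =
     {y_free i * x_free i - 1 | i. i \<in> {1..n}} \<union>
     {x_free i * y_free j - y_free j * x_free i | i j. i \<in> {1..n} \<and> j \<in> {1..n} \<and> i \<noteq> j} \<union>
     {x_free i * x_free j - x_free j * x_free i | i j. i \<in> {1..n} \<and> j \<in> {1..n} \<and> i \<noteq> j} \<union>
     {y_free i * y_free j - y_free j * y_free i | i j. i \<in> {1..n} \<and> j \<in> {1..n} \<and> i \<noteq> j}"

definition one_sided_inverse_ideal :: "nat \<Rightarrow> (gen_word \<Rightarrow>\<^sub>0 'k::field) set" where
  "one_sided_inverse_ideal n = Idl\<^bsub>free_algebra n\<^esub> (one_sided_inverse_relators n)"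

definition one_sided_inverse_algebra ::
    "'k::field itself \<Rightarrow> nat \<Rightarrow> ('k, (gen_word \<Rightarrow>\<^sub>0 'k) set) module" where
  "one_sided_inverse_algebra _ n =
     ring.extend (free_algebra n Quot one_sided_inverse_ideal n)
       (module.fields (\<lambda>k P. \<Union>p\<in>P.
          one_sided_inverse_ideal n +>\<^bsub>free_algebra n\<^esub> (Poly_Mapping.single 0 k * p)))"


section \<open>Rational function fields\<close>

text \<open>
  \<^typ>\<open>(nat \<Rightarrow>\<^sub>0 nat) \<Rightarrow>\<^sub>0 'k\<close> is the polynomial ring in variables indexed by all natural numbers;
  only the variables with index in \<open>{1..n}\<close> are used.
\<close>

definition polys_in :: "nat \<Rightarrow> ((nat \<Rightarrow>\<^sub>0 nat) \<Rightarrow>\<^sub>0 'k::field) set" where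
  "polys_in n = {p. \<forall>m\<in>Poly_Mapping.keys p. Poly_Mapping.keys m \<subseteq> {1..n}}"

definition rational_function_field ::
    "'k::field itself \<Rightarrow> nat \<Rightarrow> ('k, ((nat \<Rightarrow>\<^sub>0 nat) \<Rightarrow>\<^sub>0 'k) fract) module" where
  "rational_function_field _ n =
     ring.extend
       (ring_of_type_algebra \<lparr>carrier := {Fract p q | p q. p \<in> polys_in n \<and> q \<in> polys_in n \<and> q \<noteq> 0}\<rparr>)
       (module.fields (\<lambda>k f. Fract (Poly_Mapping.single 0 k) 1 * f))"

end

theory Submission
  imports Defs
begin

text \<open>
  By the relations, \<open>S\<^sub>n\<close> is the algebra of the \<open>n\<close>-th power of the bicyclic monoid, with basis
  \<open>x\<^sup>a y\<^sup>b\<close>; it is a free right module over \<open>P = K[y\<^sub>1, \<dots>, y\<^sub>n]\<close> with basis the \<open>x\<^sup>a\<close>, so every nonzero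
  element of \<open>P\<close> is left regular. Conversely, every element is multiplied into \<open>P\<close> from the left by a
  monomial in the \<open>y\<^sub>i\<close>. Hence the homomorphism \<open>\<phi>\<close> to \<open>K(y\<^sub>1, \<dots>, y\<^sub>n)\<close> sending \<open>x\<^sub>i\<close> to \<open>y\<^sub>i\<inverse>\<close> has the
  property that each element of its kernel is killed from the left by a left regular element. Since
  the target is commutative, this yields the left Ore condition for all left regular elements, and
  \<open>s\<inverse>r \<mapsto> \<phi> r / \<phi> s\<close> is the desired isomorphism.
\<close>

section \<open>Localization at the left regular elements through a homomorphism to a field\<close>

lemma cross_multiply_fractions:
  fixes t s s' r r' a :: "'f::field"
  assumes "t * s = a * s'" "r / s = r' / s'" "s \<noteq> 0" "s' \<noteq> 0"
  shows "t * r = a * r'"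
proof -
  have "t * r = t * s * (r / s)" using assms(3) by simp
  also have "\<dots> = a * r'" using assms(1,2,4) by simp
  finally show ?thesis .
qed

text \<open>The operations of \<open>left_localization\<close> are unions over all admissible
  choices; they are evaluated by showing that every choice gives the same class and that some choice
  exists.\<close>

lemma Union_eq_single:
  assumes "A \<subseteq> {B}" and "A \<noteq> {}"
  shows "\<Union>A = B"
  using assms
  by (auto dest: subset_singletonD)

text \<open>The Ore condition is required only after applying \<open>\<phi>\<close>;
  \<open>kernel_killed\<close> lifts it to \<open>R\<close>. The map \<open>c\<close> embodies the
  scalar action on the field.\<close>

locale left_regular_fractions =
  ring R for R :: "('k, 'a, 'm) module_scheme" (structure) +
  fixes \<phi> :: "'a \<Rightarrow> 'f::field" and c :: "'k \<Rightarrow> 'f"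
  assumes hom_mult: "\<lbrakk>r \<in> carrier R; s \<in> carrier R\<rbrakk> \<Longrightarrow> \<phi> (r \<otimes> s) = \<phi> r * \<phi> s"
    and hom_add: "\<lbrakk>r \<in> carrier R; s \<in> carrier R\<rbrakk> \<Longrightarrow> \<phi> (r \<oplus> s) = \<phi> r + \<phi> s"
    and hom_one: "\<phi> \<one> = 1"
    and smult_closed: "r \<in> carrier R \<Longrightarrow> k \<odot>\<^bsub>R\<^esub> r \<in> carrier R"
    and hom_smult: "r \<in> carrier R \<Longrightarrow> \<phi> (k \<odot>\<^bsub>R\<^esub> r) = c k * \<phi> r"
    and kernel_killed: "\<lbrakk>r \<in> carrier R; \<phi> r = 0\<rbrakk> \<Longrightarrow> \<exists>t\<in>left_regular_elements R. t \<otimes> r = \<zero>"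
    and ore_image: "\<lbrakk>r \<in> carrier R; s \<in> carrier R; \<phi> s \<noteq> 0\<rbrakk> \<Longrightarrow>
      \<exists>t\<in>left_regular_elements R. \<exists>a\<in>carrier R. \<phi> t * \<phi> r = \<phi> a * \<phi> s"
begin

abbreviation C :: "'a set" where "C \<equiv> left_regular_elements R"

text \<open>The fibre over \<open>f\<close> of the quotient map on pairs. By
  \<open>left_frac_eq_fraction_class\<close> the nonempty fibres are exactly the left
  fractions.\<close>

definition fraction_class :: "'f \<Rightarrow> ('a \<times> 'a) set" where
  "fraction_class f = {(s, r). s \<in> C \<and> r \<in> carrier R \<and> \<phi> r / \<phi> s = f}"

definition fractions :: "'f set" where
  "fractions = {\<phi> r / \<phi> s | r s. r \<in> carrier R \<and> s \<in> C}"

lemma fractionsI: "\<lbrakk>r \<in> carrier R; s \<in> C\<rbrakk> \<Longrightarrow> \<phi> r / \<phi> s \<in> fractions"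
  unfolding fractions_def by blast

lemma fractionsE:
  assumes "f \<in> fractions"
  obtains r s where "r \<in> carrier R" "s \<in> C" "f = \<phi> r / \<phi> s"
  using assms unfolding fractions_def mem_Collect_eq by (elim exE conjE)

section \<open>Left regular elements and the Ore condition\<close>

lemma C_carrier: "s \<in> C \<Longrightarrow> s \<in> carrier R"
  by (simp add: left_regular_elements_def)

lemma C_cancel: "\<lbrakk>s \<in> C; r \<in> carrier R; r \<otimes> s = \<zero>\<rbrakk> \<Longrightarrow> r = \<zero>"
  by (simp add: left_regular_elements_def)

lemma hom_zero: "\<phi> \<zero> = 0"
proof -
  have "\<phi> \<zero> + \<phi> \<zero> = \<phi> \<zero> + 0"
    using hom_add[of \<zero> \<zero>] by simp
  then show ?thesis by (rule add_left_imp_eq)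
qed

lemma hom_diff:
  assumes "r \<in> carrier R" "s \<in> carrier R" shows "\<phi> (r \<ominus> s) = \<phi> r - \<phi> s"
proof -
  have "\<phi> (r \<ominus> s) + \<phi> s = \<phi> r"
    using assms hom_add[of "r \<ominus> s" s] by (simp add: a_minus_def a_assoc l_neg)
  then show ?thesis by (simp add: algebra_simps)
qed

lemma zero_not_one: "\<zero> \<noteq> \<one>"
  using hom_zero hom_one by force

lemma zero_notin_C: "\<zero> \<notin> C"
  using C_cancel[of \<zero> \<one>] zero_not_one by auto

lemma one_in_C: "\<one> \<in> C"
  by (simp add: left_regular_elements_def)

lemma mult_in_C:
  assumes "s \<in> C" "t \<in> C" shows "s \<otimes> t \<in> C"
proof -
  have "r = \<zero>" if "r \<in> carrier R" "r \<otimes> (s \<otimes> t) = \<zero>" for r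
  proof -
    have "(r \<otimes> s) \<otimes> t = \<zero>"
      using that m_assoc[of r s t] assms[THEN C_carrier] by simp
    then have "r \<otimes> s = \<zero>"
      using C_cancel[OF assms(2)] that(1) C_carrier[OF assms(1)] by blast
    then show ?thesis using C_cancel[OF assms(1) that(1)] by blast
  qed
  with assms[THEN C_carrier] show ?thesis unfolding left_regular_elements_def by blast
qed

text \<open>If \<open>s\<close> were in the kernel, some left regular \<open>t\<close> would kill it
  from the left; left regularity of \<open>s\<close> then forces \<open>t = \<zero>\<close>, which
  is not left regular.\<close>

lemma hom_C_nonzero: "s \<in> C \<Longrightarrow> \<phi> s \<noteq> 0"
proof
  assume s: "s \<in> C" "\<phi> s = 0"
  then obtain t where "t \<in> C" "t \<otimes> s = \<zero>"
    using kernel_killed C_carrier by blast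
  then show False using C_cancel[OF s(1), of t] zero_notin_C C_carrier by auto
qed

text \<open>The image condition makes \<open>t \<otimes> r\<close> and \<open>a \<otimes> s\<close>
  agree up to an element of the kernel. A further left regular factor \<open>u\<close> kills this
  difference.\<close>

lemma ore:
  assumes r: "r \<in> carrier R" and s: "s \<in> C"
  obtains t a where "t \<in> C" "a \<in> carrier R" "t \<otimes> r = a \<otimes> s"
proof -
  obtain t a where ta: "t \<in> C" "a \<in> carrier R" "\<phi> t * \<phi> r = \<phi> a * \<phi> s"
    using ore_image[OF r C_carrier hom_C_nonzero] s by blast
  note carr = C_carrier[OF ta(1)] C_carrier[OF s] r ta(2)
  have "\<phi> (t \<otimes> r \<ominus> a \<otimes> s) = 0"
    using carr ta(3) by (simp add: hom_diff hom_mult)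
  then obtain u where u: "u \<in> C" "u \<otimes> (t \<otimes> r \<ominus> a \<otimes> s) = \<zero>"
    using kernel_killed[of "t \<otimes> r \<ominus> a \<otimes> s"] carr by auto
  have "(u \<otimes> t) \<otimes> r \<ominus> (u \<otimes> a) \<otimes> s = \<zero>"
    using u(2) carr C_carrier[OF u(1)]
    by (simp add: a_minus_def r_distr r_minus m_assoc)
  then have "(u \<otimes> t) \<otimes> r = (u \<otimes> a) \<otimes> s"
    using carr C_carrier[OF u(1)] by simp
  then show thesis
    using that[of "u \<otimes> t" "u \<otimes> a"] mult_in_C u(1) ta(1,2) C_carrier by simp
qed

theorem left_denominator_set_C: "left_denominator_set R C"
proof -
  have "multiplicative_set R C"
    unfolding multiplicative_set_def
    using C_carrier one_in_C mult_in_C zero_notin_C by auto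
  moreover have "(\<lambda>t. t \<otimes> r) ` C \<inter> (\<lambda>a. a \<otimes> s) ` carrier R \<noteq> {}"
    if rs: "r \<in> carrier R" "s \<in> C" for r s
  proof -
    obtain t a where "t \<in> C" "a \<in> carrier R" "t \<otimes> r = a \<otimes> s"
      using ore[OF rs] .
    then show ?thesis by blast
  qed
  ultimately have "left_Ore_set R C"
    unfolding left_Ore_set_def by blast
  \<comment> \<open>Left regularity of \<open>s\<close> already gives \<open>r = \<zero>\<close>, so
    \<open>\<one>\<close> serves as \<open>t\<close>.\<close>
  moreover have "\<exists>t\<in>C. t \<otimes> r = \<zero>" if "r \<in> carrier R" "s \<in> C" "r \<otimes> s = \<zero>" for r s
    using C_cancel[OF that(2,1,3)] one_in_C by force
  ultimately show ?thesis
    unfolding left_denominator_set_def by blast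
qed

text \<open>The set \<open>C\<close> bounds all competing sets by definition and is itself one of
  them.\<close>

lemma largest_eq_C: "largest_left_regular_denominator_set R = C"
  unfolding largest_left_regular_denominator_set_def
  by (rule Greatest_equality) (use left_denominator_set_C in auto)

section \<open>The localization computed through quotients in the field\<close>

lemma left_frac_rel_iff:
  "((s, r), (s', r')) \<in> left_frac_rel R C \<longleftrightarrow>
     s \<in> C \<and> r \<in> carrier R \<and> s' \<in> C \<and> r' \<in> carrier R \<and> \<phi> r / \<phi> s = \<phi> r' / \<phi> s'"
  (is "_ \<longleftrightarrow> ?rhs")
proof
  assume "((s, r), (s', r')) \<in> left_frac_rel R C"
  then obtain a b where *: "s \<in> C" "r \<in> carrier R" "s' \<in> C" "r' \<in> carrier R"
      "a \<in> carrier R" "b \<in> carrier R" "a \<otimes> s = b \<otimes> s'" "a \<otimes> s \<in> C" "a \<otimes> r = b \<otimes> r'"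
    unfolding left_frac_rel_def by auto
  have e: "\<phi> a * \<phi> s = \<phi> b * \<phi> s'" "\<phi> a * \<phi> r = \<phi> b * \<phi> r'"
    using hom_mult[of a s] hom_mult[of b s'] hom_mult[of a r] hom_mult[of b r'] * C_carrier by auto
  \<comment> \<open>The common denominator \<open>a \<otimes> s\<close> is left regular, so its
    image is nonzero; hence \<open>\<phi> a\<close> and \<open>\<phi> b\<close> are nonzero and
    cancel from the quotients.\<close>
  then have nz: "\<phi> a \<noteq> 0" "\<phi> b \<noteq> 0"
    using hom_C_nonzero[OF *(8)] hom_mult[of a s] * C_carrier by auto
  have "\<phi> r / \<phi> s = (\<phi> a * \<phi> r) / (\<phi> a * \<phi> s)" using nz(1) by simp
  also have "\<dots> = (\<phi> b * \<phi> r') / (\<phi> b * \<phi> s')" by (simp only: e)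
  also have "\<dots> = \<phi> r' / \<phi> s'" using nz(2) by simp
  finally show ?rhs using * by blast
next
  assume rhs: ?rhs
  \<comment> \<open>The Ore condition only equalizes the denominators. The numerators then agree
    under \<open>\<phi>\<close>, and a further factor \<open>u\<close> from
    \<open>kernel_killed\<close> makes them equal in \<open>R\<close>.\<close>
  then obtain t a where ta: "t \<in> C" "a \<in> carrier R" "t \<otimes> s = a \<otimes> s'"
    using ore[of s s'] C_carrier by blast
  have nz: "\<phi> s \<noteq> 0" "\<phi> s' \<noteq> 0" "\<phi> t \<noteq> 0"
    using rhs ta hom_C_nonzero by auto
  note carr = rhs ta C_carrier
  have "\<phi> t * \<phi> s = \<phi> a * \<phi> s'"
    using hom_mult[of t s] hom_mult[of a s'] carr by simp
  then have "\<phi> t * \<phi> r = \<phi> a * \<phi> r'"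
    using cross_multiply_fractions rhs nz by blast
  then have "\<phi> (t \<otimes> r \<ominus> a \<otimes> r') = 0"
    using carr by (simp add: hom_diff hom_mult)
  then obtain u where u: "u \<in> C" "u \<otimes> (t \<otimes> r \<ominus> a \<otimes> r') = \<zero>"
    using kernel_killed carr by (metis m_closed minus_closed)
  have uc: "u \<in> carrier R" "t \<in> carrier R" "s \<in> carrier R" "s' \<in> carrier R"
    using u carr by auto
  have "(u \<otimes> t) \<otimes> r \<ominus> (u \<otimes> a) \<otimes> r' = \<zero>"
    using u(2) carr uc by (simp add: a_minus_def r_distr r_minus m_assoc)
  then have "(u \<otimes> t) \<otimes> r = (u \<otimes> a) \<otimes> r'"
    using carr uc by simp
  moreover have "(u \<otimes> t) \<otimes> s = (u \<otimes> a) \<otimes> s'"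
    using ta(2,3) uc by (simp add: m_assoc)
  moreover have "(u \<otimes> t) \<otimes> s \<in> C"
    using mult_in_C u(1) ta(1) rhs by blast
  ultimately show "((s, r), (s', r')) \<in> left_frac_rel R C"
    using rhs uc ta(2) unfolding left_frac_rel_def by blast
qed

lemma fraction_classD:
  assumes "(s, r) \<in> fraction_class f"
  shows "s \<in> C" "r \<in> carrier R" "f = \<phi> r / \<phi> s"
  using assms by (simp_all add: fraction_class_def)

lemma left_frac_eq_fraction_class:
  assumes "s \<in> C" "r \<in> carrier R" shows "left_frac R C s r = fraction_class (\<phi> r / \<phi> s)"
  using assms by (auto simp: left_frac_def fraction_class_def left_frac_rel_iff)

lemma fraction_class_nonempty: "f \<in> fractions \<Longrightarrow> \<exists>s r. (s, r) \<in> fraction_class f"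
  by (auto simp: fractions_def fraction_class_def)

lemma carrier_left_localization: "carrier (left_localization R C) = fraction_class ` fractions"
proof -
  have "(C \<times> carrier R) // left_frac_rel R C = (\<lambda>(s, r). left_frac R C s r) ` (C \<times> carrier R)"
    by (auto simp: quotient_def left_frac_def)
  also have "\<dots> = (\<lambda>(s, r). fraction_class (\<phi> r / \<phi> s)) ` (C \<times> carrier R)"
    by (rule image_cong) (auto simp: left_frac_eq_fraction_class)
  also have "\<dots> = fraction_class ` fractions"
    by (auto simp: fractions_def)
  finally show ?thesis by (simp add: left_localization_def)
qed

lemma mult_left_localization:
  assumes "f \<in> fractions" "g \<in> fractions"
  shows "fraction_class f \<otimes>\<^bsub>left_localization R C\<^esub> fraction_class g = fraction_class (f * g)"
proof -
  let ?U = "{left_frac R C (u \<otimes> s) (a \<otimes> q) | s r t q u a.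
        (s, r) \<in> fraction_class f \<and> (t, q) \<in> fraction_class g \<and> u \<in> C \<and> a \<in> carrier R \<and> u \<otimes> r = a \<otimes> t}"
  have "left_frac R C (u \<otimes> s) (a \<otimes> q) = fraction_class (f * g)"
    if "(s, r) \<in> fraction_class f" "(t, q) \<in> fraction_class g" "u \<in> C" "a \<in> carrier R" "u \<otimes> r = a \<otimes> t" for s r t q u a
  proof -
    have *: "s \<in> C" "r \<in> carrier R" "f = \<phi> r / \<phi> s" "t \<in> C" "q \<in> carrier R" "g = \<phi> q / \<phi> t"
      using fraction_classD[OF that(1)] fraction_classD[OF that(2)] by simp_all
    have nz: "\<phi> s \<noteq> 0" "\<phi> t \<noteq> 0" "\<phi> u \<noteq> 0"
      using * that hom_C_nonzero by auto
    have "\<phi> u * \<phi> r = \<phi> a * \<phi> t"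
      using that(3-5) * hom_mult[of u r] hom_mult[of a t] C_carrier by simp
    \<comment> \<open>The image of \<open>a\<close> is determined by those of \<open>u\<close>,
      \<open>r\<close> and \<open>t\<close>; after substituting it, \<open>u\<close> cancels and the
      result no longer depends on the choices.\<close>
    then have "\<phi> a = \<phi> u * \<phi> r / \<phi> t" using nz by (simp add: field_simps)
    then have "\<phi> (a \<otimes> q) / \<phi> (u \<otimes> s) = f * g"
      using that(3,4) *(1,2,4,5) nz C_carrier unfolding *(3,6)
      by (simp add: hom_mult field_simps)
    then show ?thesis
      using left_frac_eq_fraction_class[of "u \<otimes> s" "a \<otimes> q"] mult_in_C that(3,4) *(1,5) by simp
  qed
  then have "?U \<subseteq> {fraction_class (f * g)}" by blast
  moreover have "?U \<noteq> {}"
  proof -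
    obtain s r t q where "(s, r) \<in> fraction_class f" "(t, q) \<in> fraction_class g"
      using fraction_class_nonempty assms by meson
    moreover from this obtain u a where "u \<in> C" "a \<in> carrier R" "u \<otimes> r = a \<otimes> t"
      using ore[of r t] by (auto simp: fraction_class_def)
    ultimately show ?thesis by blast
  qed
  ultimately have "\<Union>?U = fraction_class (f * g)" by (rule Union_eq_single)
  then show ?thesis by (simp add: left_localization_def)
qed

lemma add_left_localization:
  assumes "f \<in> fractions" "g \<in> fractions"
  shows "fraction_class f \<oplus>\<^bsub>left_localization R C\<^esub> fraction_class g = fraction_class (f + g)"
proof -
  let ?U = "{left_frac R C (a \<otimes> s) ((a \<otimes> r) \<oplus> (b \<otimes> q)) | s r t q a b.
        (s, r) \<in> fraction_class f \<and> (t, q) \<in> fraction_class g \<and> a \<in> carrier R \<and> b \<in> carrier R \<and>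
        a \<otimes> s = b \<otimes> t \<and> a \<otimes> s \<in> C}"
  have "left_frac R C (a \<otimes> s) ((a \<otimes> r) \<oplus> (b \<otimes> q)) = fraction_class (f + g)"
    if "(s, r) \<in> fraction_class f" "(t, q) \<in> fraction_class g" "a \<in> carrier R" "b \<in> carrier R"
      "a \<otimes> s = b \<otimes> t" "a \<otimes> s \<in> C" for s r t q a b
  proof -
    have *: "s \<in> C" "r \<in> carrier R" "f = \<phi> r / \<phi> s" "t \<in> C" "q \<in> carrier R" "g = \<phi> q / \<phi> t"
      using fraction_classD[OF that(1)] fraction_classD[OF that(2)] by simp_all
    have e: "\<phi> a * \<phi> s = \<phi> b * \<phi> t" "\<phi> (a \<otimes> s) = \<phi> a * \<phi> s"
      using that(3-5) *(1,4) hom_mult[of a s] hom_mult[of b t] C_carrier by simp_all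
    then have nz: "\<phi> s \<noteq> 0" "\<phi> t \<noteq> 0" "\<phi> a \<noteq> 0" "\<phi> b \<noteq> 0"
      using * hom_C_nonzero[OF that(6)] by auto
    have "\<phi> ((a \<otimes> r) \<oplus> (b \<otimes> q)) / \<phi> (a \<otimes> s)
        = (\<phi> a * \<phi> r) / (\<phi> a * \<phi> s) + (\<phi> b * \<phi> q) / (\<phi> b * \<phi> t)"
      using that(3,4) *(1,2,4,5) C_carrier e(1)
      by (simp add: hom_mult hom_add add_divide_distrib)
    also have "\<dots> = f + g" using nz * by simp
    finally show ?thesis
      using left_frac_eq_fraction_class[OF that(6), of "(a \<otimes> r) \<oplus> (b \<otimes> q)"] that(3,4) *(2,5) by simp
  qed
  then have "?U \<subseteq> {fraction_class (f + g)}" by blast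
  moreover have "?U \<noteq> {}"
  proof -
    obtain s r t q where st: "(s, r) \<in> fraction_class f" "(t, q) \<in> fraction_class g"
      using fraction_class_nonempty assms by meson
    then have C: "s \<in> C" "t \<in> C" using fraction_classD by blast+
    \<comment> \<open>The Ore condition provides \<open>a\<close> in \<open>C\<close>, not merely in
      the carrier, so the common denominator \<open>a \<otimes> s\<close> is again left
      regular.\<close>
    then obtain a b where ab: "a \<in> C" "b \<in> carrier R" "a \<otimes> s = b \<otimes> t"
      using ore[of s t] C_carrier by auto
    moreover have "a \<in> carrier R" "a \<otimes> s \<in> C" using ab mult_in_C C C_carrier by blast+
    ultimately show ?thesis using st by blast
  qed
  ultimately have "\<Union>?U = fraction_class (f + g)" by (rule Union_eq_single)
  then show ?thesis by (simp add: left_localization_def)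
qed

lemma smult_left_localization:
  assumes "f \<in> fractions"
  shows "k \<odot>\<^bsub>left_localization R C\<^esub> fraction_class f = fraction_class (c k * f)"
proof -
  let ?U = "{left_frac R C s (k \<odot>\<^bsub>R\<^esub> r) | s r. (s, r) \<in> fraction_class f}"
  have "left_frac R C s (k \<odot>\<^bsub>R\<^esub> r) = fraction_class (c k * f)" if "(s, r) \<in> fraction_class f" for s r
  proof -
    note * = fraction_classD[OF that]
    have "left_frac R C s (k \<odot>\<^bsub>R\<^esub> r) = fraction_class (\<phi> (k \<odot>\<^bsub>R\<^esub> r) / \<phi> s)"
      using *(1) smult_closed[OF *(2)] by (rule left_frac_eq_fraction_class)
    then show ?thesis unfolding hom_smult[OF *(2)] *(3) by simp
  qed
  then have "?U \<subseteq> {fraction_class (c k * f)}" by blast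
  moreover have "?U \<noteq> {}" using fraction_class_nonempty[OF assms] by blast
  ultimately have "\<Union>?U = fraction_class (c k * f)" by (rule Union_eq_single)
  then show ?thesis by (simp add: left_localization_def)
qed

text \<open>The localization is a copy of \<open>fractions\<close>: each class is the fibre over one
  value, and the operations on classes are those of the field. \<open>F\<close> may be any record
  with these operations.\<close>

theorem algebra_isomorphic_fractions:
  fixes F :: "('k, 'f, 'l) module_scheme"
  assumes F: "carrier F = fractions" "\<one>\<^bsub>F\<^esub> = 1"
    "\<And>f g. f \<otimes>\<^bsub>F\<^esub> g = f * g" "\<And>f g. f \<oplus>\<^bsub>F\<^esub> g = f + g"
    "\<And>k f. k \<odot>\<^bsub>F\<^esub> f = c k * f"
    and closed: "\<And>f g. \<lbrakk>f \<in> fractions; g \<in> fractions\<rbrakk> \<Longrightarrow> f * g \<in> fractions"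
      "\<And>f g. \<lbrakk>f \<in> fractions; g \<in> fractions\<rbrakk> \<Longrightarrow> f + g \<in> fractions"
  shows "algebra_isomorphic (left_localization R C) F"
proof -
  let ?Q = "left_localization R C"
  \<comment> \<open>All representatives of a class have the same quotient, so the arbitrary choice
    is harmless and \<open>h\<close> inverts \<open>fraction_class\<close>.\<close>
  define h where "h P = (let sr = SOME sr. sr \<in> P in \<phi> (snd sr) / \<phi> (fst sr))" for P
  have h: "h (fraction_class f) = f" if "f \<in> fractions" for f
  proof -
    have "\<exists>sr. sr \<in> fraction_class f" using fraction_class_nonempty[OF that] by blast
    then have "(SOME sr. sr \<in> fraction_class f) \<in> fraction_class f" by (rule someI_ex)
    then show ?thesis
      unfolding h_def Let_def using fraction_classD(3) by (metis prod.collapse)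
  qed
  have one: "1 \<in> fractions" "\<one>\<^bsub>?Q\<^esub> = fraction_class 1"
  proof -
    show "1 \<in> fractions"
      using one_in_C hom_one unfolding fractions_def by force
    show "\<one>\<^bsub>?Q\<^esub> = fraction_class 1"
      using left_frac_eq_fraction_class[OF one_in_C one_closed] by (simp add: left_localization_def hom_one)
  qed
  have smult: "c k * f \<in> fractions" if "f \<in> fractions" for k f
  proof -
    obtain r s where "r \<in> carrier R" "s \<in> C" "f = \<phi> r / \<phi> s"
      using \<open>f \<in> fractions\<close> by (rule fractionsE)
    then have "c k * f = \<phi> (k \<odot>\<^bsub>R\<^esub> r) / \<phi> s" "k \<odot>\<^bsub>R\<^esub> r \<in> carrier R" "s \<in> C"
      by (simp_all add: smult_closed hom_smult)
    then show ?thesis using fractionsI by metis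
  qed
  have "h \<in> ring_hom ?Q F"
    by (rule ring_hom_memI)
      (auto simp: carrier_left_localization mult_left_localization add_left_localization
        h F one closed)
  moreover have "bij_betw h (carrier ?Q) (carrier F)"
    by (rule bij_betw_byWitness[of _ fraction_class]) (auto simp: carrier_left_localization h F)
  ultimately have "h \<in> ring_iso ?Q F" by (simp add: ring_iso_def)
  moreover have "\<forall>k. \<forall>P\<in>carrier ?Q. h (k \<odot>\<^bsub>?Q\<^esub> P) = k \<odot>\<^bsub>F\<^esub> h P"
    by (auto simp: carrier_left_localization smult_left_localization h F smult)
  ultimately show ?thesis unfolding algebra_isomorphic_def by blast
qed

end

section \<open>The algebra of the bicyclic monoid\<close>

lemma poly_mapping_keys_induct [consumes 1, case_names zero single add]:
  fixes p :: "'a \<Rightarrow>\<^sub>0 'b::comm_monoid_add"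
  assumes "Poly_Mapping.keys p \<subseteq> W"
    and "P 0"
    and "\<And>w k. w \<in> W \<Longrightarrow> P (Poly_Mapping.single w k)"
    and "\<And>p q. \<lbrakk>P p; P q\<rbrakk> \<Longrightarrow> P (p + q)"
  shows "P p"
proof -
  have "P (\<Sum>w\<in>A. Poly_Mapping.single w (Poly_Mapping.lookup p w))" if "finite A" "A \<subseteq> W" for A
    using that by (induction A rule: finite_induct) (auto intro: assms)
  then have "P (\<Sum>w\<in>Poly_Mapping.keys p. Poly_Mapping.single w (Poly_Mapping.lookup p w))"
    using assms(1) by simp
  moreover have "(\<Sum>w\<in>Poly_Mapping.keys p. Poly_Mapping.single w (Poly_Mapping.lookup p w)) = p"
    by (rule poly_mapping_eqI)
      (auto simp: lookup_sum lookup_single when_def sum.delta' in_keys_iff)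
  ultimately show ?thesis by simp
qed

lemmas poly_mapping_single_induct = poly_mapping_keys_induct[OF subset_UNIV, case_names zero single add]

text \<open>Only additivity in the coefficient is demanded, so the target needs no scalar action.
  Pushforwards, slices and the map to fractions are all instances.\<close>

locale additive_family =
  fixes g :: "'m \<Rightarrow> 'k::ring \<Rightarrow> 'b::ab_group_add"
  assumes family_add: "g w (k + l) = g w k + g w l"
begin

definition extension :: "('m \<Rightarrow>\<^sub>0 'k) \<Rightarrow> 'b" where
  "extension p = (\<Sum>w\<in>Poly_Mapping.keys p. g w (Poly_Mapping.lookup p w))"

lemma family_zero: "g w 0 = 0"
  using family_add[of w 0 0] by simp

lemma extension_superset:
  assumes "finite A" "Poly_Mapping.keys p \<subseteq> A"
  shows "extension p = (\<Sum>w\<in>A. g w (Poly_Mapping.lookup p w))"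
  unfolding extension_def
  by (rule sum.mono_neutral_left) (use assms in \<open>auto simp: in_keys_iff family_zero\<close>)

lemma extension_zero [simp]: "extension 0 = 0"
  by (simp add: extension_def)

lemma extension_single [simp]: "extension (Poly_Mapping.single w k) = g w k"
  by (simp add: extension_def family_zero)

lemma extension_add: "extension (p + q) = extension p + extension q"
proof -
  let ?A = "Poly_Mapping.keys p \<union> Poly_Mapping.keys q"
  have "extension r = (\<Sum>w\<in>?A. g w (Poly_Mapping.lookup r w))" if "r \<in> {p, q, p + q}" for r
    using that Poly_Mapping.keys_add[of p q] by (intro extension_superset) auto
  then show ?thesis
    by (simp add: lookup_add family_add sum.distrib)
qed

lemma extension_diff: "extension (p - q) = extension p - extension q"
  using extension_add[of "p - q" q] by (simp add: algebra_simps)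

end

locale multiplicative_family = additive_family g
  for g :: "'m::monoid_add \<Rightarrow> 'k::ring_1 \<Rightarrow> 'b::ring_1" +
  assumes family_mult: "g (v + w) (k * l) = g v k * g w l"
    and family_one: "g 0 1 = 1"
begin

lemma extension_one: "extension 1 = 1"
  by (simp add: family_one flip: single_one)

text \<open>Both sides are additive in each factor, which reduces the claim to products of two
  monomials.\<close>

lemma extension_mult: "extension (p * q) = extension p * extension q"
proof (induction p rule: poly_mapping_single_induct)
  case (single v k)
  show ?case
    by (induction q rule: poly_mapping_single_induct)
      (simp_all add: mult_single family_mult extension_add distrib_left)
qed (simp_all add: extension_add distrib_right)

end

text \<open>Pushforward of finitely supported functions; coefficients of monomials with the same
  image add up. For a monoid homomorphism \<open>f\<close> it is the induced map of monoid
  algebras.\<close>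

definition push :: "('a \<Rightarrow> 'b) \<Rightarrow> ('a \<Rightarrow>\<^sub>0 'k::ring_1) \<Rightarrow> 'b \<Rightarrow>\<^sub>0 'k" where
  "push f = additive_family.extension (\<lambda>w k. Poly_Mapping.single (f w) k)"

context
begin

interpretation additive_family "\<lambda>w k. Poly_Mapping.single (f w) (k::'k::ring_1)" for f
  by standard (simp add: single_add)

lemma push_zero [simp]: "push f 0 = 0"
  unfolding push_def by simp

lemma push_single [simp]: "push f (Poly_Mapping.single w k) = Poly_Mapping.single (f w) k"
  unfolding push_def by simp

lemma push_add: "push f (p + q) = push f p + push f q"
  unfolding push_def by (rule extension_add)

lemma push_diff: "push f (p - q) = push f p - push f q"
  unfolding push_def by (rule extension_diff)

end

lemma
  fixes p q :: "'a::monoid_add \<Rightarrow>\<^sub>0 'k::ring_1" and f :: "'a \<Rightarrow> 'b::monoid_add"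
  assumes "f 0 = 0" "\<And>v w. f (v + w) = f v + f w"
  shows push_one: "push f (1 :: 'a \<Rightarrow>\<^sub>0 'k) = 1" and push_mult: "push f (p * q) = push f p * push f q"
proof -
  interpret multiplicative_family "\<lambda>w k. Poly_Mapping.single (f w) (k::'k)"
    by standard (simp_all add: single_add mult_single assms)
  show "push f (1 :: 'a \<Rightarrow>\<^sub>0 'k) = 1"
    unfolding push_def by (fact extension_one)
  show "push f (p * q) = push f p * push f q"
    unfolding push_def by (fact extension_mult)
qed

lemma keys_push:
  assumes "Poly_Mapping.keys p \<subseteq> W"
  shows "Poly_Mapping.keys (push f p) \<subseteq> f ` W"
  using assms
proof (induction p rule: poly_mapping_keys_induct)
  case (add p q)
  then show ?case using Poly_Mapping.keys_add[of "push f p" "push f q"] by (simp add: push_add) blast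
qed auto

section \<open>The bicyclic monomials and freeness over the polynomials in \<open>y\<close>\<close>

lemma zero_minus_exponent [simp]: "(0 :: 'a \<Rightarrow>\<^sub>0 nat) - v = 0"
  by (rule poly_mapping_eqI) (simp add: lookup_minus)

text \<open>\<open>Bic a b\<close> stands for the monomial \<open>x\<^sup>a y\<^sup>b\<close>; the truncated subtractions below implement \<open>y\<^sub>i x\<^sub>i = 1\<close>.\<close>

datatype bicyclic = Bic (xexp: "nat \<Rightarrow>\<^sub>0 nat") (yexp: "nat \<Rightarrow>\<^sub>0 nat")

instantiation bicyclic :: monoid_add
begin

definition zero_bicyclic :: bicyclic where
  "0 = Bic 0 0"

definition plus_bicyclic :: "bicyclic \<Rightarrow> bicyclic \<Rightarrow> bicyclic" where
  "v + w = Bic (xexp v + (xexp w - yexp v)) ((yexp v - xexp w) + yexp w)"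

instance
  by standard
    (auto simp: zero_bicyclic_def plus_bicyclic_def lookup_add lookup_minus intro!: poly_mapping_eqI)

end

lemma Bic_add: "Bic a b + Bic c d = Bic (a + (c - b)) ((b - c) + d)"
  by (simp add: plus_bicyclic_def)

abbreviation emb :: "((nat \<Rightarrow>\<^sub>0 nat) \<Rightarrow>\<^sub>0 'k::field) \<Rightarrow> bicyclic \<Rightarrow>\<^sub>0 'k" where
  "emb \<equiv> push (Bic 0)"

lemma emb_mult: "emb (p * q) = emb p * emb q"
  by (rule push_mult) (simp_all add: zero_bicyclic_def Bic_add)

text \<open>The coefficient of \<open>x\<^sup>a\<close> in the free right module over the polynomials in \<open>y\<close>.\<close>

definition slice :: "(nat \<Rightarrow>\<^sub>0 nat) \<Rightarrow> (bicyclic \<Rightarrow>\<^sub>0 'k::field) \<Rightarrow> (nat \<Rightarrow>\<^sub>0 nat) \<Rightarrow>\<^sub>0 'k" where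
  "slice a = additive_family.extension
     (\<lambda>w k. Poly_Mapping.single (yexp w) k when xexp w = a)"

context
begin

interpretation additive_family
  "\<lambda>w k. Poly_Mapping.single (yexp w) (k::'k::field) when xexp w = a" for a
  by standard (simp add: single_add when_def)

lemma slice_zero [simp]: "slice a 0 = 0"
  unfolding slice_def by simp

lemma slice_single [simp]:
  "slice a (Poly_Mapping.single w k) = (Poly_Mapping.single (yexp w) k when xexp w = a)"
  unfolding slice_def by (rule extension_single)

lemma slice_add: "slice a (r + s) = slice a r + slice a s"
  unfolding slice_def by (rule extension_add)

end

lemma lookup_slice: "Poly_Mapping.lookup (slice a r) b = Poly_Mapping.lookup r (Bic a b)"
proof (induction r rule: poly_mapping_single_induct)
  case (single w k)
  then show ?case by (cases w) (auto simp: lookup_single when_def)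
qed (simp_all add: slice_add lookup_add)

text \<open>Right multiplication by a monomial in \<open>y\<close> leaves the \<open>x\<close>
  exponent unchanged, as \<open>0 - b = 0\<close> in \<open>Bic_add\<close>; hence slices are linear
  over the polynomials.\<close>

lemma slice_mult_emb: "slice a (r * emb q) = slice a r * q"
proof (induction r rule: poly_mapping_single_induct)
  case (single w k)
  show ?case
  proof (induction q rule: poly_mapping_single_induct)
    case (single b l)
    show ?case by (cases w) (simp add: mult_single Bic_add when_def)
  qed (simp_all add: slice_add push_add distrib_left)
qed (simp_all add: slice_add distrib_right)

text \<open>By freeness the claim can be checked slice by slice, and there the polynomials have no
  zero divisors.\<close>

lemma mult_emb_eq_zero:
  assumes "r * emb q = 0" "q \<noteq> 0"
  shows "r = 0"
proof (rule poly_mapping_eqI)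
  fix w
  have "slice (xexp w) r * q = slice (xexp w) (r * emb q)"
    by (rule slice_mult_emb[symmetric])
  also have "\<dots> = 0"
    unfolding assms(1) by (rule poly_mapping_eqI) (simp add: lookup_slice)
  finally have "slice (xexp w) r = 0"
    using assms(2) by simp
  then show "Poly_Mapping.lookup r w = Poly_Mapping.lookup 0 w"
    using lookup_slice[of "xexp w" r "yexp w"] by simp
qed

lemma single_one_nonzero [simp]: "Poly_Mapping.single m (1::'k::field) \<noteq> 0"
  by (metis lookup_single_eq lookup_zero zero_neq_one)

text \<open>The homomorphism sending \<open>x\<^sup>a y\<^sup>b\<close> to \<open>y\<^sup>b / y\<^sup>a\<close>.\<close>

definition bicyclic_fract :: "(bicyclic \<Rightarrow>\<^sub>0 'k::field) \<Rightarrow> ((nat \<Rightarrow>\<^sub>0 nat) \<Rightarrow>\<^sub>0 'k) fract" where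
  "bicyclic_fract = additive_family.extension
     (\<lambda>w k. Fract (Poly_Mapping.single (yexp w) k) (Poly_Mapping.single (xexp w) 1))"

context
begin

interpretation multiplicative_family
  "\<lambda>w (k::'k::field). Fract (Poly_Mapping.single (yexp w) k) (Poly_Mapping.single (xexp w) (1::'k))"
proof
  fix v w :: bicyclic and k l :: 'k
  show "Fract (Poly_Mapping.single (yexp w) (k + l)) (Poly_Mapping.single (xexp w) 1) =
      Fract (Poly_Mapping.single (yexp w) k) (Poly_Mapping.single (xexp w) 1) +
      Fract (Poly_Mapping.single (yexp w) l) (Poly_Mapping.single (xexp w) 1)"
    by (simp add: single_add eq_fract distrib_right distrib_left)
  \<comment> \<open>This is the equality of the two fractions after cross-multiplication. Under
    truncated subtraction, \<open>(k - m) + m\<close> and \<open>(m - k) + k\<close> both equal the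
    maximum of \<open>k\<close> and \<open>m\<close>.\<close>
  have "xexp v + (xexp w - yexp v) + (yexp v + yexp w) = (yexp v - xexp w) + yexp w + (xexp v + xexp w)"
    by (rule poly_mapping_eqI) (simp add: lookup_add lookup_minus)
  then show "Fract (Poly_Mapping.single (yexp (v + w)) (k * l)) (Poly_Mapping.single (xexp (v + w)) 1) =
      Fract (Poly_Mapping.single (yexp v) k) (Poly_Mapping.single (xexp v) 1) *
      Fract (Poly_Mapping.single (yexp w) l) (Poly_Mapping.single (xexp w) 1)"
    by (simp add: plus_bicyclic_def mult_single eq_fract ac_simps)
qed (simp add: zero_bicyclic_def One_fract_def)

lemma bicyclic_fract_zero [simp]: "bicyclic_fract 0 = 0"
  unfolding bicyclic_fract_def by (rule extension_zero)

lemma bicyclic_fract_single: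
  "bicyclic_fract (Poly_Mapping.single w k) = Fract (Poly_Mapping.single (yexp w) k) (Poly_Mapping.single (xexp w) 1)"
  unfolding bicyclic_fract_def by (rule extension_single)

lemma bicyclic_fract_one [simp]: "bicyclic_fract 1 = 1"
  unfolding bicyclic_fract_def by (rule extension_one)

lemma bicyclic_fract_add: "bicyclic_fract (r + s) = bicyclic_fract r + bicyclic_fract s"
  unfolding bicyclic_fract_def by (rule extension_add)

lemma bicyclic_fract_mult: "bicyclic_fract (r * s) = bicyclic_fract r * bicyclic_fract s"
  unfolding bicyclic_fract_def by (rule extension_mult)

end

lemma bicyclic_fract_emb: "bicyclic_fract (emb p) = Fract p 1"
proof (induction p rule: poly_mapping_single_induct)
  case (add p q)
  then show ?case by (simp add: push_add bicyclic_fract_add)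
qed (simp_all add: bicyclic_fract_single Zero_fract_def)

lemma bicyclic_fract_scale: "bicyclic_fract (Poly_Mapping.single 0 k * r) = Fract (Poly_Mapping.single 0 k) 1 * bicyclic_fract r"
  by (simp add: bicyclic_fract_mult bicyclic_fract_single zero_bicyclic_def)

section \<open>Restriction to \<open>n\<close> variables\<close>

definition exponents_in :: "nat \<Rightarrow> (nat \<Rightarrow>\<^sub>0 nat) set" where
  "exponents_in n = {m. Poly_Mapping.keys m \<subseteq> {1..n}}"

definition bicyclic_in :: "nat \<Rightarrow> bicyclic set" where
  "bicyclic_in n = {w. xexp w \<in> exponents_in n \<and> yexp w \<in> exponents_in n}"

lemma exponents_in_simps [simp]:
  "0 \<in> exponents_in n"
  "a \<in> exponents_in n \<Longrightarrow> b \<in> exponents_in n \<Longrightarrow> a + b \<in> exponents_in n"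
  "a \<in> exponents_in n \<Longrightarrow> a - b \<in> exponents_in n"
  "i \<in> {1..n} \<Longrightarrow> Poly_Mapping.single i k \<in> exponents_in n"
proof -
  show "0 \<in> exponents_in n" by (simp add: exponents_in_def)
  show "a \<in> exponents_in n \<Longrightarrow> b \<in> exponents_in n \<Longrightarrow> a + b \<in> exponents_in n"
    using Poly_Mapping.keys_add[of a b] by (auto simp: exponents_in_def)
  have "Poly_Mapping.keys (a - b) \<subseteq> Poly_Mapping.keys a"
    by (auto simp: in_keys_iff lookup_minus)
  then show "a \<in> exponents_in n \<Longrightarrow> a - b \<in> exponents_in n"
    by (auto simp: exponents_in_def)
  show "i \<in> {1..n} \<Longrightarrow> Poly_Mapping.single i k \<in> exponents_in n"
    by (simp add: exponents_in_def)
qed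

lemma polys_in_iff: "p \<in> polys_in n \<longleftrightarrow> Poly_Mapping.keys p \<subseteq> exponents_in n"
  by (auto simp: polys_in_def exponents_in_def)

lemma polys_in_zero [simp]: "0 \<in> polys_in n"
  by (simp add: polys_in_iff)

lemma polys_in_one [simp]: "1 \<in> polys_in n"
  by (simp add: polys_in_iff)

lemma polys_in_single [simp]: "m \<in> exponents_in n \<Longrightarrow> Poly_Mapping.single m k \<in> polys_in n"
  by (auto simp: polys_in_iff)

lemma polys_in_add [simp]: "\<lbrakk>p \<in> polys_in n; q \<in> polys_in n\<rbrakk> \<Longrightarrow> p + q \<in> polys_in n"
  using Poly_Mapping.keys_add by (fastforce simp: polys_in_iff)

lemma polys_in_mult [simp]: "\<lbrakk>p \<in> polys_in n; q \<in> polys_in n\<rbrakk> \<Longrightarrow> p * q \<in> polys_in n"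
  using keys_mult[of p q] exponents_in_simps(2) by (fastforce simp: polys_in_iff)

definition rational_functions_in :: "nat \<Rightarrow> ((nat \<Rightarrow>\<^sub>0 nat) \<Rightarrow>\<^sub>0 'k::field) fract set" where
  "rational_functions_in n = {Fract p q | p q. p \<in> polys_in n \<and> q \<in> polys_in n \<and> q \<noteq> 0}"

lemma rational_functions_inI:
  "\<lbrakk>p \<in> polys_in n; q \<in> polys_in n; q \<noteq> 0\<rbrakk> \<Longrightarrow> Fract p q \<in> rational_functions_in n"
  unfolding rational_functions_in_def by blast

lemma rational_functions_inE:
  assumes "f \<in> rational_functions_in n"
  obtains p q where "p \<in> polys_in n" "q \<in> polys_in n" "q \<noteq> 0" "f = Fract p q"
  using assms unfolding rational_functions_in_def mem_Collect_eq by (elim exE conjE)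

lemma
  assumes "f \<in> rational_functions_in n" "g \<in> rational_functions_in n"
  shows rational_functions_in_add: "f + g \<in> rational_functions_in n"
    and rational_functions_in_mult: "f * g \<in> rational_functions_in n"
    and rational_functions_in_divide: "g \<noteq> 0 \<Longrightarrow> f / g \<in> rational_functions_in n"
proof -
  obtain p q where f: "p \<in> polys_in n" "q \<in> polys_in n" "q \<noteq> 0" "f = Fract p q"
    using assms(1) by (rule rational_functions_inE)
  obtain p' q' where g: "p' \<in> polys_in n" "q' \<in> polys_in n" "q' \<noteq> 0" "g = Fract p' q'"
    using assms(2) by (rule rational_functions_inE)
  show "f + g \<in> rational_functions_in n" "f * g \<in> rational_functions_in n"
    using f g by (auto intro!: rational_functions_inI)
  show "f / g \<in> rational_functions_in n" if "g \<noteq> 0"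
    using f g that by (auto simp: Zero_fract_def eq_fract intro!: rational_functions_inI)
qed

lemma bicyclic_fract_in_rational_functions:
  assumes "Poly_Mapping.keys r \<subseteq> bicyclic_in n"
  shows "bicyclic_fract r \<in> rational_functions_in n"
  using assms
proof (induction r rule: poly_mapping_keys_induct)
  case zero
  show ?case using rational_functions_inI[of 0 n 1] by (simp add: Zero_fract_def)
next
  case (single w k)
  then show ?case
    by (simp add: bicyclic_in_def bicyclic_fract_single rational_functions_inI)
next
  case (add p q)
  then show ?case by (simp add: bicyclic_fract_add rational_functions_in_add)
qed

text \<open>Since \<open>y^a x^a = 1\<close>, left multiplication by \<open>y^a\<close> removes
  \<open>x^a\<close>. For a sum, the product of the monomials clearing the two summands clears both,
  because these monomials commute.\<close>

lemma monomial_clears_x: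
  assumes "Poly_Mapping.keys r \<subseteq> bicyclic_in n"
  shows "\<exists>m\<in>exponents_in n. \<exists>p. emb (Poly_Mapping.single m 1) * r = emb p"
  using assms
proof (induction r rule: poly_mapping_keys_induct)
  case zero
  show ?case by (rule bexI[of _ 0], rule exI[of _ 0]) auto
next
  case (single w k)
  have "emb (Poly_Mapping.single (xexp w) 1) * Poly_Mapping.single w k = emb (Poly_Mapping.single (yexp w) k)"
    by (cases w) (simp add: mult_single Bic_add)
  then show ?case using single unfolding bicyclic_in_def by blast
next
  case (add r s)
  then obtain m p m' p' where *: "m \<in> exponents_in n" "m' \<in> exponents_in n"
      "emb (Poly_Mapping.single m 1) * r = emb p" "emb (Poly_Mapping.single m' 1) * s = emb p'"
    by blast
  let ?e = "\<lambda>m. Poly_Mapping.single m 1"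
  \<comment> \<open>The two monomials are ordered differently for each summand, so that the one
    clearing it stands next to it.\<close>
  have "emb (?e (m + m')) * (r + s) = emb (?e m' * ?e m) * r + emb (?e m * ?e m') * s"
    by (simp add: mult_single distrib_left add.commute)
  also have "\<dots> = emb (?e m') * (emb (?e m) * r) + emb (?e m) * (emb (?e m') * s)"
    by (simp only: emb_mult mult.assoc)
  also have "\<dots> = emb (?e m' * p + ?e m * p')"
    by (simp only: * emb_mult push_add)
  finally show ?case using *(1,2) exponents_in_simps(2) by blast
qed

section \<open>Normal forms in the algebra of one-sided inverses\<close>

lemma ring_of_type_algebra_simps [simp]:
  "carrier (ring_of_type_algebra :: 'a::ring_1 ring) = UNIV"
  "x \<otimes>\<^bsub>ring_of_type_algebra\<^esub> y = x * (y::'a)"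
  "x \<oplus>\<^bsub>ring_of_type_algebra\<^esub> y = x + (y::'a)"
  "\<one>\<^bsub>ring_of_type_algebra\<^esub> = (1::'a)"
  "\<zero>\<^bsub>ring_of_type_algebra\<^esub> = (0::'a)"
  by (simp_all add: ring_of_type_algebra_def)

text \<open>Negatives are products with \<open>-1\<close>, and zero is
  \<open>1 + (-1)\<close>.\<close>

lemma ring_subring_of_type:
  fixes A :: "'a::ring_1 set"
  assumes "1 \<in> A" "-1 \<in> A" "\<And>x y. \<lbrakk>x \<in> A; y \<in> A\<rbrakk> \<Longrightarrow> x + y \<in> A"
    "\<And>x y. \<lbrakk>x \<in> A; y \<in> A\<rbrakk> \<Longrightarrow> x * y \<in> A"
  shows "Ring.ring (ring_of_type_algebra \<lparr>carrier := A\<rparr>)"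
proof -
  have "0 \<in> A" using assms(3)[OF assms(1,2)] by simp
  moreover have "- x \<in> A" if "x \<in> A" for x
    using assms(4)[OF assms(2) that] by simp
  ultimately show ?thesis
    using assms
    by (intro ringI abelian_groupI monoidI)
      (auto simp: add.assoc add.commute mult.assoc distrib_left distrib_right
        intro!: bexI[of _ "- x" for x])
qed

section \<open>The free algebra and the ideal of relations\<close>

definition letters_in :: "nat \<Rightarrow> generator set" where
  "letters_in n = gen_x ` {1..n} \<union> gen_y ` {1..n}"

definition words_in :: "nat \<Rightarrow> gen_word set" where
  "words_in n = {w. set (letters w) \<subseteq> letters_in n}"

lemma words_in_zero [simp]: "0 \<in> words_in n"
  by (simp add: words_in_def zero_gen_word_def)

lemma words_in_add: "\<lbrakk>v \<in> words_in n; w \<in> words_in n\<rbrakk> \<Longrightarrow> v + w \<in> words_in n"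
  by (simp add: words_in_def plus_gen_word_def)

lemma carrier_free_algebra: "carrier (free_algebra n) = {p. Poly_Mapping.keys p \<subseteq> words_in n}"
  by (auto simp: free_algebra_def words_in_def letters_in_def)

lemma free_algebra_simps [simp]:
  "p \<otimes>\<^bsub>free_algebra n\<^esub> q = p * q"
  "p \<oplus>\<^bsub>free_algebra n\<^esub> q = p + q"
  "\<one>\<^bsub>free_algebra n\<^esub> = 1"
  "\<zero>\<^bsub>free_algebra n\<^esub> = 0"
  by (simp_all add: free_algebra_def)

lemma single_in_free_algebra: "w \<in> words_in n \<Longrightarrow> Poly_Mapping.single w k \<in> carrier (free_algebra n)"
  by (auto simp: carrier_free_algebra)

lemma mult_in_free_algebra:
  "\<lbrakk>p \<in> carrier (free_algebra n); q \<in> carrier (free_algebra n)\<rbrakk> \<Longrightarrow> p * q \<in> carrier (free_algebra n)"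
  using keys_mult[of p q] words_in_add by (fastforce simp: carrier_free_algebra)

lemma add_in_free_algebra:
  "\<lbrakk>p \<in> carrier (free_algebra n); q \<in> carrier (free_algebra n)\<rbrakk> \<Longrightarrow> p + q \<in> carrier (free_algebra n)"
  using Poly_Mapping.keys_add[of p q] by (auto simp: carrier_free_algebra)

lemma minus_in_free_algebra:
  "\<lbrakk>p \<in> carrier (free_algebra n); q \<in> carrier (free_algebra n)\<rbrakk> \<Longrightarrow> p - q \<in> carrier (free_algebra n)"
  using Poly_Mapping.keys_diff[of p q] by (auto simp: carrier_free_algebra)

lemma ring_free_algebra: "Ring.ring (free_algebra n :: (gen_word \<Rightarrow>\<^sub>0 'k::field) ring)"
proof -
  have "free_algebra n = ring_of_type_algebra \<lparr>carrier := carrier (free_algebra n)\<rparr>"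
    by (simp add: free_algebra_def)
  moreover have "Poly_Mapping.single 0 (-1) = (-1 :: gen_word \<Rightarrow>\<^sub>0 'k)"
    by (simp add: single_uminus)
  ultimately show ?thesis
    using ring_subring_of_type[of "carrier (free_algebra n)"]
      single_in_free_algebra[of 0 n 1] single_in_free_algebra[of 0 n "-1"]
      add_in_free_algebra mult_in_free_algebra
    by (metis single_one words_in_zero)
qed

lemma relators_in_free_algebra: "one_sided_inverse_relators n \<subseteq> carrier (free_algebra n)"
proof -
  have *: "x_free i \<in> carrier (free_algebra n)" "y_free i \<in> carrier (free_algebra n)" if "i \<in> {1..n}" for i
    using that unfolding x_free_def y_free_def
    by (auto intro!: single_in_free_algebra simp: words_in_def letters_in_def)
  have "1 \<in> carrier (free_algebra n)"
    using single_in_free_algebra[of 0 n 1] by simp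
  then show ?thesis
    unfolding one_sided_inverse_relators_def
    by (auto intro!: minus_in_free_algebra mult_in_free_algebra *)
qed

lemma ideal_one_sided_inverse: "ideal (one_sided_inverse_ideal n) (free_algebra n)"
  unfolding one_sided_inverse_ideal_def
  by (rule ring.genideal_ideal[OF ring_free_algebra relators_in_free_algebra])

lemma relator_in_ideal:
  "r \<in> one_sided_inverse_relators n \<Longrightarrow> r \<in> one_sided_inverse_ideal n"
  using ring.genideal_self[OF ring_free_algebra relators_in_free_algebra]
  unfolding one_sided_inverse_ideal_def by blast

lemma ideal_zero: "0 \<in> one_sided_inverse_ideal n"
  using additive_subgroup.zero_closed[OF ideal.axioms(1)[OF ideal_one_sided_inverse]] by simp

lemma ideal_add:
  "\<lbrakk>p \<in> one_sided_inverse_ideal n; q \<in> one_sided_inverse_ideal n\<rbrakk> \<Longrightarrow> p + q \<in> one_sided_inverse_ideal n"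
  using additive_subgroup.a_closed[OF ideal.axioms(1)[OF ideal_one_sided_inverse]] by force

lemma ideal_lmult:
  "\<lbrakk>p \<in> one_sided_inverse_ideal n; q \<in> carrier (free_algebra n)\<rbrakk> \<Longrightarrow> q * p \<in> one_sided_inverse_ideal n"
  using ideal.I_l_closed[OF ideal_one_sided_inverse] by force

lemma ideal_rmult:
  "\<lbrakk>p \<in> one_sided_inverse_ideal n; q \<in> carrier (free_algebra n)\<rbrakk> \<Longrightarrow> p * q \<in> one_sided_inverse_ideal n"
  using ideal.I_r_closed[OF ideal_one_sided_inverse] by force

lemma ideal_uminus:
  assumes "p \<in> one_sided_inverse_ideal n"
  shows "- p \<in> one_sided_inverse_ideal n"
  using ideal_lmult[OF assms single_in_free_algebra[of 0 n "-1"]] by (simp add: single_uminus)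

section \<open>Congruence of words modulo the relations\<close>

definition word_eq :: "'k::field itself \<Rightarrow> nat \<Rightarrow> generator list \<Rightarrow> generator list \<Rightarrow> bool" where
  "word_eq _ n v w \<longleftrightarrow>
     Poly_Mapping.single (Word v) (1::'k) - Poly_Mapping.single (Word w) 1 \<in> one_sided_inverse_ideal n"

text \<open>The monomial with exponents \<open>a\<close>, as a word whose blocks follow the order of
  \<open>L\<close>; the list \<open>[1..<Suc n]\<close> later fixes the normal form.\<close>

definition power_word :: "(nat \<Rightarrow> generator) \<Rightarrow> nat list \<Rightarrow> (nat \<Rightarrow>\<^sub>0 nat) \<Rightarrow> generator list" where
  "power_word g L a = concat (map (\<lambda>i. replicate (Poly_Mapping.lookup a i) (g i)) L)"

lemma power_word_Nil [simp]: "power_word g [] a = []"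
  and power_word_Cons [simp]:
    "power_word g (i # L) a = replicate (Poly_Mapping.lookup a i) (g i) @ power_word g L a"
  by (simp_all add: power_word_def)

lemma power_word_cong:
  "(\<And>i. i \<in> set L \<Longrightarrow> Poly_Mapping.lookup a i = Poly_Mapping.lookup b i) \<Longrightarrow> power_word g L a = power_word g L b"
  unfolding power_word_def by (metis (no_types, lifting) map_cong)

lemma set_power_word:
  "\<lbrakk>set L \<subseteq> {1..n}; g \<in> {gen_x, gen_y}\<rbrakk> \<Longrightarrow> set (power_word g L a) \<subseteq> letters_in n"
  by (induction L) (auto simp: letters_in_def)

context
  fixes K :: "'k::field itself" and n :: nat
begin

private abbreviation weq :: "generator list \<Rightarrow> generator list \<Rightarrow> bool" (infix "\<sim>" 50) where
  "v \<sim> w \<equiv> word_eq K n v w"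

lemma weq_refl [simp]: "v \<sim> v"
  by (simp add: word_eq_def ideal_zero)

lemma weq_sym: "v \<sim> w \<Longrightarrow> w \<sim> v"
  unfolding word_eq_def by (drule ideal_uminus) simp

lemma weq_trans [trans]: "\<lbrakk>u \<sim> v; v \<sim> w\<rbrakk> \<Longrightarrow> u \<sim> w"
  unfolding word_eq_def by (drule (1) ideal_add) simp

text \<open>The letter conditions keep the outer words inside the free algebra on \<open>n\<close>
  pairs of generators, where the two-sided ideal absorbs them.\<close>

lemma weq_cong:
  assumes "v \<sim> w" "set u \<subseteq> letters_in n" "set u' \<subseteq> letters_in n"
  shows "u @ v @ u' \<sim> u @ w @ u'"
proof -
  let ?s = "\<lambda>v. Poly_Mapping.single (Word v) (1::'k)"
  have "?s u * (?s v - ?s w) * ?s u' \<in> one_sided_inverse_ideal n"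
    using assms by (intro ideal_rmult ideal_lmult single_in_free_algebra)
      (auto simp: word_eq_def words_in_def)
  then show ?thesis
    by (simp add: word_eq_def right_diff_distrib left_diff_distrib mult_single plus_gen_word_def)
qed

lemma weq_cong_left: "\<lbrakk>v \<sim> w; set u \<subseteq> letters_in n\<rbrakk> \<Longrightarrow> u @ v \<sim> u @ w"
  using weq_cong[of v w u "[]"] by simp

lemma weq_cong_right: "\<lbrakk>v \<sim> w; set u \<subseteq> letters_in n\<rbrakk> \<Longrightarrow> v @ u \<sim> w @ u"
  using weq_cong[of v w "[]" u] by simp

lemma weq_cancel:
  assumes "i \<in> {1..n}" shows "[gen_y i, gen_x i] \<sim> []"
proof -
  have "y_free i * x_free i - 1 \<in> one_sided_inverse_ideal n"
    using assms by (intro relator_in_ideal) (auto simp: one_sided_inverse_relators_def)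
  moreover have "(1 :: gen_word \<Rightarrow>\<^sub>0 'k) = Poly_Mapping.single (Word []) 1"
    by (metis single_one zero_gen_word_def)
  ultimately show ?thesis
    by (simp add: word_eq_def x_free_def y_free_def mult_single plus_gen_word_def)
qed

lemma weq_commute:
  assumes "i \<in> {1..n}" "j \<in> {1..n}" "i \<noteq> j" "g \<in> {gen_x, gen_y}" "h \<in> {gen_x, gen_y}"
  shows "[g i, h j] \<sim> [h j, g i]"
proof -
  have "[gen_x i, gen_x j] \<sim> [gen_x j, gen_x i]" "[gen_y i, gen_y j] \<sim> [gen_y j, gen_y i]"
    "[gen_x i, gen_y j] \<sim> [gen_y j, gen_x i]"
    if "i \<in> {1..n}" "j \<in> {1..n}" "i \<noteq> j" for i j
  proof -
    have "x_free i * x_free j - x_free j * x_free i \<in> one_sided_inverse_ideal n"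
      "y_free i * y_free j - y_free j * y_free i \<in> one_sided_inverse_ideal n"
      "x_free i * y_free j - y_free j * x_free i \<in> one_sided_inverse_ideal n"
      by (rule relator_in_ideal, use that in \<open>unfold one_sided_inverse_relators_def, blast\<close>)+
    then show "[gen_x i, gen_x j] \<sim> [gen_x j, gen_x i]" "[gen_y i, gen_y j] \<sim> [gen_y j, gen_y i]"
      "[gen_x i, gen_y j] \<sim> [gen_y j, gen_x i]"
      by (simp_all add: word_eq_def x_free_def y_free_def mult_single plus_gen_word_def)
  qed
  then show ?thesis using assms weq_sym by blast
qed

lemma weq_move:
  assumes "set v \<subseteq> letters_in n" "g \<in> letters_in n" "\<And>h. h \<in> set v \<Longrightarrow> [g, h] \<sim> [h, g]"
  shows "g # v \<sim> v @ [g]"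
  using assms
proof (induction v)
  case (Cons h v)
  have "g # h # v \<sim> h # g # v"
    using weq_cong_right[of "[g, h]" "[h, g]" v] Cons.prems by simp
  also have "h # g # v \<sim> h # (v @ [g])"
    using weq_cong_left[of "g # v" "v @ [g]" "[h]"] Cons by simp
  finally show ?case by simp
qed simp

text \<open>The condition on \<open>a\<close> says that no letter \<open>g i\<close> occurs in the
  word, so all its letters have an index other than \<open>i\<close> and commute with
  \<open>h i\<close>. This lets \<open>y_i\<close> pass an \<open>x\<close> monomial free of
  \<open>x_i\<close>.\<close>

lemma weq_pass:
  assumes "i \<in> {1..n}" "set L \<subseteq> {1..n}" "g \<in> {gen_x, gen_y}" "h \<in> {gen_x, gen_y}"
    and "\<And>j. \<lbrakk>j \<in> set L; j = i\<rbrakk> \<Longrightarrow> Poly_Mapping.lookup a j = 0"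
  shows "h i # power_word g L a \<sim> power_word g L a @ [h i]"
proof (rule weq_move)
  show "set (power_word g L a) \<subseteq> letters_in n" using assms(2,3) by (rule set_power_word)
  show "h i \<in> letters_in n" using assms(1,4) by (auto simp: letters_in_def)
  fix l assume "l \<in> set (power_word g L a)"
  then obtain j where j: "l = g j" "j \<in> set L" "Poly_Mapping.lookup a j \<noteq> 0"
    by (auto simp: power_word_def)
  have "j \<in> {1..n}" "i \<noteq> j" using j(2,3) assms(2,5) by auto
  then show "[h i, l] \<sim> [l, h i]"
    unfolding j(1) by (intro weq_commute assms(1,3,4))
qed

text \<open>The inductive step shared by insertion and deletion: a letter crosses a block of another
  index and then acts on the rest.\<close>

lemma weq_past_replicate:
  assumes "i \<in> {1..n}" "j \<in> {1..n}" "i \<noteq> j" "g \<in> {gen_x, gen_y}" "h \<in> {gen_x, gen_y}"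
    and "h i # v \<sim> w" "set v \<subseteq> letters_in n"
  shows "h i # replicate m (g j) @ v \<sim> replicate m (g j) @ w"
proof -
  have l: "g j \<in> letters_in n" "h i \<in> letters_in n"
    using assms by (auto simp: letters_in_def)
  have "h i # replicate m (g j) \<sim> replicate m (g j) @ [h i]"
    using l weq_commute[OF assms(1-3,5,4)] by (intro weq_move) auto
  then have "h i # replicate m (g j) @ v \<sim> replicate m (g j) @ (h i # v)"
    using weq_cong_right[OF _ assms(7), of "h i # replicate m (g j)" "replicate m (g j) @ [h i]"] by simp
  also have "replicate m (g j) @ (h i # v) \<sim> replicate m (g j) @ w"
    by (rule weq_cong_left[OF assms(6)]) (use l in auto)
  finally show ?thesis .
qed

text \<open>The letter commutes past the blocks of other indices and joins its own block, which is
  unique because \<open>L\<close> is distinct.\<close>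

lemma weq_insert:
  assumes "i \<in> set L" "distinct L" "set L \<subseteq> {1..n}" "g \<in> {gen_x, gen_y}"
  shows "g i # power_word g L a \<sim> power_word g L (a + Poly_Mapping.single i 1)"
  using assms
proof (induction L)
  case (Cons j L)
  show ?case
  proof (cases "i = j")
    case True
    \<comment> \<open>Distinctness keeps \<open>i\<close> out of the tail, which therefore does not
      see the changed exponent.\<close>
    then have "power_word g L (a + Poly_Mapping.single i 1) = power_word g L a"
      using Cons.prems by (intro power_word_cong) (auto simp: lookup_add lookup_single when_def)
    then show ?thesis using True by (simp add: lookup_add)
  next
    case False
    then have "g i # power_word g L a \<sim> power_word g L (a + Poly_Mapping.single i 1)"
      using Cons by simp
    then have "g i # replicate (Poly_Mapping.lookup a j) (g j) @ power_word g L a \<sim>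
        replicate (Poly_Mapping.lookup a j) (g j) @ power_word g L (a + Poly_Mapping.single i 1)"
      by (intro weq_past_replicate set_power_word) (use False Cons.prems in auto)
    then show ?thesis using False by (auto simp: lookup_add lookup_single when_def)
  qed
qed simp

text \<open>The letter \<open>y_i\<close> travels to the block of \<open>x_i\<close> and cancels its
  first letter by \<open>y_i x_i = 1\<close>; a positive exponent makes this block nonempty.\<close>

lemma weq_delete:
  assumes "i \<in> set L" "distinct L" "set L \<subseteq> {1..n}" "Poly_Mapping.lookup a i > 0"
  shows "gen_y i # power_word gen_x L a \<sim> power_word gen_x L (a - Poly_Mapping.single i 1)"
  using assms
proof (induction L)
  case (Cons j L)
  show ?case
  proof (cases "i = j")
    case True
    obtain m where m: "Poly_Mapping.lookup a i = Suc m"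
      using assms(4) gr0_conv_Suc by blast
    let ?v = "replicate m (gen_x i) @ power_word gen_x L a"
    have "power_word gen_x L (a - Poly_Mapping.single i 1) = power_word gen_x L a"
      using True Cons.prems by (intro power_word_cong) (auto simp: lookup_minus lookup_single when_def)
    moreover have "set ?v \<subseteq> letters_in n"
      using Cons.prems set_power_word[of L n gen_x a] True by (auto simp: letters_in_def)
    then have "[gen_y i, gen_x i] @ ?v \<sim> [] @ ?v"
      using Cons.prems True by (intro weq_cong_right weq_cancel) auto
    ultimately show ?thesis using True m by (simp add: lookup_minus)
  next
    case False
    then have "gen_y i # power_word gen_x L a \<sim> power_word gen_x L (a - Poly_Mapping.single i 1)"
      using Cons by simp
    then have "gen_y i # replicate (Poly_Mapping.lookup a j) (gen_x j) @ power_word gen_x L a \<sim>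
        replicate (Poly_Mapping.lookup a j) (gen_x j) @ power_word gen_x L (a - Poly_Mapping.single i 1)"
      by (intro weq_past_replicate set_power_word) (use False Cons.prems in auto)
    then show ?thesis using False by (auto simp: lookup_minus lookup_single when_def)
  qed
qed simp

end

section \<open>Evaluation of words in the bicyclic monoid and normal forms\<close>

fun bic_letter :: "generator \<Rightarrow> bicyclic" where
  "bic_letter (gen_x i) = Bic (Poly_Mapping.single i 1) 0"
| "bic_letter (gen_y i) = Bic 0 (Poly_Mapping.single i 1)"

definition bic_word :: "gen_word \<Rightarrow> bicyclic" where
  "bic_word w = sum_list (map bic_letter (letters w))"

lemma bic_word_zero: "bic_word 0 = 0"
  by (simp add: bic_word_def zero_gen_word_def)

lemma bic_word_add: "bic_word (v + w) = bic_word v + bic_word w"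
  by (simp add: bic_word_def plus_gen_word_def)

definition normal_word :: "nat \<Rightarrow> bicyclic \<Rightarrow> gen_word" where
  "normal_word n b =
     Word (power_word gen_x [1..<Suc n] (xexp b) @ power_word gen_y [1..<Suc n] (yexp b))"

lemma minus_zero_exponent [simp]: "a - (0 :: 'a \<Rightarrow>\<^sub>0 nat) = a"
  by (rule poly_mapping_eqI) (simp add: lookup_minus)

text \<open>Letters are prepended to a normal form: \<open>x_i\<close> joins the \<open>x\<close>
  part, while \<open>y_i\<close> cancels an \<open>x_i\<close> if there is one and otherwise passes
  the \<open>x\<close> part to join the \<open>y\<close> part. These cases mirror the truncated
  subtractions in the bicyclic product.\<close>

lemma weq_normal_word:
  assumes "set w \<subseteq> letters_in n"
  shows "word_eq TYPE('k::field) n w (letters (normal_word n (bic_word (Word w))))"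
  using assms
proof (induction w)
  case Nil
  have "power_word g L 0 = []" for g L
    by (induction L) simp_all
  then show ?case
    by (simp add: bic_word_def normal_word_def zero_bicyclic_def)
next
  case (Cons l w)
  define L where "L = [1..<Suc n]"
  have nw: "normal_word n c = Word (power_word gen_x L (xexp c) @ power_word gen_y L (yexp c))" for c
    by (simp only: normal_word_def L_def)
  define a b where "a = xexp (bic_word (Word w))" and "b = yexp (bic_word (Word w))"
  let ?X = "power_word gen_x L" and ?Y = "power_word gen_y L"
  have L: "set L \<subseteq> {1..n}" "distinct L" by (auto simp: L_def)
  have letters: "set (?X c) \<subseteq> letters_in n" "set (?Y c) \<subseteq> letters_in n" for c
    using set_power_word[OF L(1)] by auto
  have bw: "bic_word (Word w) = Bic a b" by (simp add: a_def b_def)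
  have step: "bic_word (Word (l # w)) = bic_letter l + Bic a b"
    using bw by (simp add: bic_word_def)
  have "word_eq TYPE('k) n w (?X a @ ?Y b)"
    using Cons by (simp add: nw bw)
  then have "word_eq TYPE('k) n ([l] @ w) ([l] @ (?X a @ ?Y b))"
    by (rule weq_cong_left) (use Cons.prems in simp)
  also have "word_eq TYPE('k) n ([l] @ (?X a @ ?Y b)) (letters (normal_word n (bic_word (Word (l # w)))))"
  proof (cases l)
    case (gen_x i)
    then have i: "i \<in> set L" using Cons.prems by (auto simp: L_def letters_in_def)
    have "word_eq TYPE('k) n ((gen_x i # ?X a) @ ?Y b) (?X (a + Poly_Mapping.single i 1) @ ?Y b)"
      by (intro weq_cong_right weq_insert i L letters) simp
    then show ?thesis
      unfolding step by (simp add: gen_x Bic_add nw add.commute)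
  next
    case (gen_y i)
    then have i: "i \<in> set L" "i \<in> {1..n}" using Cons.prems by (auto simp: L_def letters_in_def)
    show ?thesis
    proof (cases "Poly_Mapping.lookup a i > 0")
      case True
      \<comment> \<open>A positive exponent at \<open>i\<close> absorbs the unit vector, so the
        product leaves \<open>b\<close> unchanged.\<close>
      then have "Poly_Mapping.single i 1 - a = 0"
        by (intro poly_mapping_eqI) (auto simp: lookup_minus lookup_single when_def)
      moreover have "word_eq TYPE('k) n ((gen_y i # ?X a) @ ?Y b) (?X (a - Poly_Mapping.single i 1) @ ?Y b)"
        by (intro weq_cong_right weq_delete i L letters True)
      ultimately show ?thesis
        unfolding step by (simp add: gen_y Bic_add nw)
    next
      case False
      then have 0: "Poly_Mapping.lookup a i = 0" by simp
      \<comment> \<open>With exponent zero at \<open>i\<close>, neither truncated subtraction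
        changes its first argument.\<close>
      then have eq: "Poly_Mapping.single i 1 - a = Poly_Mapping.single i 1" "a - Poly_Mapping.single i 1 = a"
        by (auto intro!: poly_mapping_eqI simp: lookup_minus lookup_single when_def)
      have "word_eq TYPE('k) n ((gen_y i # ?X a) @ ?Y b) ((?X a @ [gen_y i]) @ ?Y b)"
        by (rule weq_cong_right[OF weq_pass letters(2)]) (use i L 0 in auto)
      also have "(?X a @ [gen_y i]) @ ?Y b = ?X a @ (gen_y i # ?Y b)" by simp
      also have "word_eq TYPE('k) n (?X a @ (gen_y i # ?Y b)) (?X a @ ?Y (b + Poly_Mapping.single i 1))"
        by (intro weq_cong_left weq_insert i L letters) simp
      finally show ?thesis
        unfolding step by (simp add: gen_y Bic_add nw eq add.commute del: One_nat_def)
    qed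
  qed
  finally show ?case by simp
qed

text \<open>Reduction of words to normal form, extended additively. If the evaluation of
  \<open>p\<close> vanishes, it places \<open>p\<close> itself in the ideal.\<close>

lemma diff_normal_form_in_ideal:
  assumes "p \<in> carrier (free_algebra n)"
  shows "p - push (normal_word n) (push bic_word p) \<in> one_sided_inverse_ideal n"
proof -
  have "Poly_Mapping.keys p \<subseteq> words_in n"
    using assms by (simp add: carrier_free_algebra)
  then show ?thesis
  proof (induction p rule: poly_mapping_keys_induct)
    case (single w k)
    let ?v = "normal_word n (bic_word w)"
    have "word_eq TYPE('a) n (letters w) (letters ?v)"
      using weq_normal_word[of "letters w" n] single by (simp add: words_in_def)
    then have "Poly_Mapping.single 0 k * (Poly_Mapping.single w 1 - Poly_Mapping.single ?v 1)
        \<in> one_sided_inverse_ideal n"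
      unfolding word_eq_def by (intro ideal_lmult single_in_free_algebra) simp_all
    then show ?case by (simp add: right_diff_distrib mult_single)
  next
    case (add p q)
    from ideal_add[OF this] show ?case by (simp add: push_add algebra_simps)
  qed (simp add: ideal_zero)
qed

text \<open>Unit exponents at distinct indices do not interact under truncated subtraction, so these
  generators commute; at equal indices the difference is zero, which gives
  \<open>y_i x_i = 1\<close>.\<close>

lemma push_bic_word_relator:
  fixes r :: "gen_word \<Rightarrow>\<^sub>0 'k::field"
  assumes "r \<in> one_sided_inverse_relators n"
  shows "push bic_word r = 0"
proof -
  note hom = push_mult[of bic_word, OF bic_word_zero bic_word_add]
    push_one[of bic_word, OF bic_word_zero bic_word_add]
  define e where "e i = Poly_Mapping.single i (1::nat)" for i :: nat
  have minus: "e i - e j = e i" if "i \<noteq> j" for i j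
    using that by (intro poly_mapping_eqI) (auto simp: e_def lookup_minus lookup_single when_def)
  have gen: "push bic_word (x_free i) = Poly_Mapping.single (Bic (e i) 0) (1::'k)"
    "push bic_word (y_free i) = Poly_Mapping.single (Bic 0 (e i)) (1::'k)" for i
    by (simp_all add: x_free_def y_free_def bic_word_def e_def)
  have one: "Poly_Mapping.single (Bic 0 0) (1::'k) = 1"
    by (simp flip: zero_bicyclic_def)
  show ?thesis
    using assms unfolding one_sided_inverse_relators_def
    by (elim UnE CollectE exE conjE; hypsubst)
      (simp_all add: push_diff hom gen mult_single Bic_add minus one add.commute)
qed

section \<open>The quotient algebra inside the algebra of the bicyclic monoid\<close>

lemma ring_extend:
  assumes "Ring.ring A"
  shows "Ring.ring (ring.extend A m)"
proof -
  interpret A: ring A by fact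
  show ?thesis
    by (intro ringI abelian_groupI monoidI)
      (auto simp: ring.defs A.m_assoc A.l_distr A.r_distr A.a_assoc
        intro: A.add.l_inv_ex A.a_comm)
qed

text \<open>Evaluation kills the ideal, so it is constant on each coset and the image is a
  singleton. The form with \<open>the_elem\<close> is that of the isomorphism theorem for quotient
  rings.\<close>

definition coset_to_bicyclic :: "(gen_word \<Rightarrow>\<^sub>0 'k::field) set \<Rightarrow> bicyclic \<Rightarrow>\<^sub>0 'k" where
  "coset_to_bicyclic P = the_elem (push bic_word ` P)"

context
  fixes K :: "'k::field itself" and n :: nat
begin

private abbreviation (input) "F \<equiv> free_algebra n :: (gen_word \<Rightarrow>\<^sub>0 'k) ring"
private abbreviation (input) "I \<equiv> one_sided_inverse_ideal n :: (gen_word \<Rightarrow>\<^sub>0 'k) set"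
private abbreviation (input) "R \<equiv> one_sided_inverse_algebra K n"

interpretation hom: ring_hom_ring F "ring_of_type_algebra :: (bicyclic \<Rightarrow>\<^sub>0 'k) ring" "push bic_word"
proof (rule ring_hom_ringI2)
  show "Ring.ring F" by (rule ring_free_algebra)
  have "Ring.ring (ring_of_type_algebra \<lparr>carrier := UNIV :: (bicyclic \<Rightarrow>\<^sub>0 'k) set\<rparr>)"
    by (rule ring_subring_of_type) simp_all
  then show "Ring.ring (ring_of_type_algebra :: (bicyclic \<Rightarrow>\<^sub>0 'k) ring)"
    by (simp add: ring_of_type_algebra_def)
  show "push bic_word \<in> ring_hom F (ring_of_type_algebra :: (bicyclic \<Rightarrow>\<^sub>0 'k) ring)"
    by (rule ring_hom_memI)
      (simp_all add: push_add push_mult push_one bic_word_zero bic_word_add)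
qed

text \<open>The relators evaluate to zero, which gives one inclusion; an element evaluating to zero
  differs from its zero normal form by a member of the ideal, which gives the other. Injectivity of
  the coset map follows.\<close>

lemma kernel_push_bic_word:
  "a_kernel F (ring_of_type_algebra :: (bicyclic \<Rightarrow>\<^sub>0 'k) ring) (push bic_word) = I" (is "?Ker = I")
proof -
  have ker: "?Ker = {p \<in> carrier F. push bic_word p = 0}"
    by (simp only: a_kernel_def' ring_of_type_algebra_simps)
  have "p \<in> I" if "p \<in> carrier F" "push bic_word p = 0" for p
    using diff_normal_form_in_ideal[OF that(1)] unfolding that(2) by simp
  moreover have "I \<subseteq> ?Ker"
    unfolding one_sided_inverse_ideal_def
  proof (rule hom.R.genideal_minimal[OF hom.kernel_is_ideal])
    show "one_sided_inverse_relators n \<subseteq> ?Ker"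
      unfolding ker using relators_in_free_algebra push_bic_word_relator by blast
  qed
  ultimately show ?thesis unfolding ker by blast
qed

lemma one_sided_inverse_simps:
  "carrier R = carrier (F Quot I)"
  "monoid.mult R = monoid.mult (F Quot I)"
  "add R = add (F Quot I)"
  "\<one>\<^bsub>R\<^esub> = \<one>\<^bsub>F Quot I\<^esub>"
  "\<zero>\<^bsub>R\<^esub> = \<zero>\<^bsub>F Quot I\<^esub>"
  "k \<odot>\<^bsub>R\<^esub> P = (\<Union>p\<in>P. I +>\<^bsub>F\<^esub> (Poly_Mapping.single 0 k * p))"
  by (simp_all add: one_sided_inverse_algebra_def ring.defs module.defs)

lemma ring_one_sided_inverse: "Ring.ring R"
  unfolding one_sided_inverse_algebra_def
  by (rule ring_extend[OF ideal.quotient_is_ring[OF ideal_one_sided_inverse]])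

lemma one_sided_inverse_carrierE:
  assumes "P \<in> carrier R"
  obtains p where "p \<in> carrier F" "P = I +>\<^bsub>F\<^esub> p"
  using assms by (auto simp: one_sided_inverse_simps FactRing_def A_RCOSETS_def')

lemma one_sided_inverse_carrierI: "p \<in> carrier F \<Longrightarrow> I +>\<^bsub>F\<^esub> p \<in> carrier R"
  by (auto simp: one_sided_inverse_simps FactRing_def A_RCOSETS_def')

text \<open>The scalar action is a union over representatives; they differ by members of the ideal,
  which scalars preserve, so all contribute the same coset.\<close>

lemma smult_coset:
  assumes "p \<in> carrier F"
  shows "k \<odot>\<^bsub>R\<^esub> (I +>\<^bsub>F\<^esub> p) = I +>\<^bsub>F\<^esub> (Poly_Mapping.single 0 k * p)"
proof -
  interpret I: ideal I F by (rule ideal_one_sided_inverse)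
  let ?c = "Poly_Mapping.single 0 k"
  have c: "?c \<in> carrier F" by (simp add: single_in_free_algebra)
  have "I +>\<^bsub>F\<^esub> (?c * q) = I +>\<^bsub>F\<^esub> (?c * p)" if q: "q \<in> I +>\<^bsub>F\<^esub> p" for q
  proof -
    obtain i where i: "i \<in> I" "q = i + p"
      using q by (auto simp: a_r_coset_def')
    then have "?c * q = ?c * i + ?c * p" by (simp add: distrib_left)
    moreover have "?c * i \<in> I" using i(1) c by (rule ideal_lmult)
    ultimately have "?c * q \<in> I +>\<^bsub>F\<^esub> (?c * p)"
      by (auto simp: a_r_coset_def')
    then show ?thesis
      using I.a_repr_independence' mult_in_free_algebra[OF c assms] by metis
  qed
  moreover have "p \<in> I +>\<^bsub>F\<^esub> p"
    using I.a_rcos_self[OF assms] .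
  ultimately show ?thesis unfolding one_sided_inverse_simps by blast
qed

lemma coset_to_bicyclic_coset:
  "p \<in> carrier F \<Longrightarrow> coset_to_bicyclic (I +>\<^bsub>F\<^esub> p) = push bic_word p"
  unfolding coset_to_bicyclic_def
  using hom.the_elem_simp unfolding kernel_push_bic_word .

lemma coset_to_bicyclic_hom:
  "coset_to_bicyclic \<in> ring_hom R (ring_of_type_algebra :: (bicyclic \<Rightarrow>\<^sub>0 'k) ring)"
proof -
  have eq: "(\<lambda>P. the_elem (push bic_word ` P)) =
      (coset_to_bicyclic :: (gen_word \<Rightarrow>\<^sub>0 'k) set \<Rightarrow> bicyclic \<Rightarrow>\<^sub>0 'k)"
    by (simp add: coset_to_bicyclic_def fun_eq_iff)
  \<comment> \<open>\<open>R\<close> and the quotient ring are records of different types with the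
    same ring operations, so the homomorphism property is transferred after unfolding it.\<close>
  show ?thesis
    using hom.the_elem_hom unfolding kernel_push_bic_word eq ring_hom_def one_sided_inverse_simps .
qed

lemmas coset_to_bicyclic_mult = ring_hom_mult[OF coset_to_bicyclic_hom, unfolded ring_of_type_algebra_simps]
lemmas coset_to_bicyclic_add = ring_hom_add[OF coset_to_bicyclic_hom, unfolded ring_of_type_algebra_simps]
lemmas coset_to_bicyclic_one = ring_hom_one[OF coset_to_bicyclic_hom, unfolded ring_of_type_algebra_simps]

lemma coset_to_bicyclic_zero: "coset_to_bicyclic \<zero>\<^bsub>R\<^esub> = 0"
proof -
  interpret R: ring R by (rule ring_one_sided_inverse)
  have "coset_to_bicyclic \<zero>\<^bsub>R\<^esub> + coset_to_bicyclic \<zero>\<^bsub>R\<^esub> = coset_to_bicyclic \<zero>\<^bsub>R\<^esub>"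
    using coset_to_bicyclic_add[OF R.zero_closed R.zero_closed] unfolding R.l_zero[OF R.zero_closed] ..
  then show ?thesis by simp
qed

lemma coset_to_bicyclic_eq_zero:
  assumes "P \<in> carrier R" "coset_to_bicyclic P = 0"
  shows "P = \<zero>\<^bsub>R\<^esub>"
proof -
  interpret R: ring R by (rule ring_one_sided_inverse)
  have "coset_to_bicyclic P = coset_to_bicyclic \<zero>\<^bsub>R\<^esub>"
    unfolding coset_to_bicyclic_zero by (rule assms(2))
  then show ?thesis
    using hom.the_elem_inj[of P "\<zero>\<^bsub>R\<^esub>"] assms(1) R.zero_closed
    unfolding kernel_push_bic_word coset_to_bicyclic_def one_sided_inverse_simps by blast
qed

text \<open>Exponents supported in \<open>{1..n}\<close> are preserved by the bicyclic product, so
  words in the first \<open>n\<close> pairs of letters evaluate to such monomials.\<close>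

lemma keys_free_to_bicyclic:
  assumes "P \<in> carrier R"
  shows "Poly_Mapping.keys (coset_to_bicyclic P) \<subseteq> bicyclic_in n"
proof -
  obtain p where p: "p \<in> carrier F" "P = I +>\<^bsub>F\<^esub> p"
    using assms by (rule one_sided_inverse_carrierE)
  have "bic_word (Word w) \<in> bicyclic_in n" if "set w \<subseteq> letters_in n" for w
    using that
  proof (induction w)
    case Nil
    show ?case by (simp add: bic_word_def bicyclic_in_def zero_bicyclic_def)
  next
    case (Cons l w)
    then have "bic_letter l \<in> bicyclic_in n"
      by (auto simp: letters_in_def bicyclic_in_def)
    with Cons show ?case
      by (simp add: bic_word_def bicyclic_in_def plus_bicyclic_def)
  qed
  then have "bic_word ` words_in n \<subseteq> bicyclic_in n"
    by (auto simp: words_in_def) (metis gen_word.collapse)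
  moreover have "Poly_Mapping.keys (push bic_word p) \<subseteq> bic_word ` words_in n"
    using p(1) by (intro keys_push) (simp add: carrier_free_algebra)
  ultimately show ?thesis
    using p by (simp add: coset_to_bicyclic_coset)
qed

lemma emb_lift:
  assumes "q \<in> polys_in n"
  obtains P where "P \<in> carrier R" "coset_to_bicyclic P = emb q"
proof -
  \<comment> \<open>A word for \<open>y^m\<close> is concatenated from powers of single letters, by
    induction on the exponent \<open>m\<close> viewed as a finitely supported function.\<close>
  have word: "\<exists>w\<in>words_in n. bic_word w = Bic 0 m" if "Poly_Mapping.keys m \<subseteq> {1..n}" for m
    using that
  proof (induction m rule: poly_mapping_keys_induct)
    case zero
    show ?case using bic_word_zero words_in_zero by (auto simp: zero_bicyclic_def)
  next
    case (single i k)
    have "bic_word (Word (replicate k (gen_y i))) = Bic 0 (Poly_Mapping.single i k)"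
    proof (induction k)
      case (Suc k)
      then show ?case
        by (simp add: bic_word_def Bic_add flip: single_add)
    qed (simp add: bic_word_def zero_bicyclic_def)
    moreover have "Word (replicate k (gen_y i)) \<in> words_in n"
      using single by (auto simp: words_in_def letters_in_def)
    ultimately show ?case by blast
  next
    case (add a b)
    then obtain v w where "v \<in> words_in n" "w \<in> words_in n" "bic_word v = Bic 0 a" "bic_word w = Bic 0 b"
      by blast
    then have "v + w \<in> words_in n" "bic_word (v + w) = Bic 0 (a + b)"
      by (simp_all add: words_in_add bic_word_add Bic_add)
    then show ?case by blast
  qed
  have "Poly_Mapping.keys q \<subseteq> exponents_in n"
    using assms by (simp add: polys_in_iff)
  then have "\<exists>p\<in>carrier F. push bic_word p = emb q"
  proof (induction q rule: poly_mapping_keys_induct)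
    case zero
    show ?case by (rule bexI[of _ 0]) (simp_all add: carrier_free_algebra)
  next
    case (single m k)
    then obtain w where "w \<in> words_in n" "bic_word w = Bic 0 m"
      using word by (auto simp: exponents_in_def)
    then show ?case
      by (intro bexI[of _ "Poly_Mapping.single w k"]) (simp_all add: single_in_free_algebra)
  next
    case (add p q)
    then obtain a b where "a \<in> carrier F" "b \<in> carrier F"
        "push bic_word a = emb p" "push bic_word b = emb q"
      by blast
    then show ?case
      by (intro bexI[of _ "a + b"]) (simp_all add: push_add add_in_free_algebra)
  qed
  then obtain p where "p \<in> carrier F" "push bic_word p = emb q" by blast
  then show thesis
    using that[of "I +>\<^bsub>F\<^esub> p"] one_sided_inverse_carrierI coset_to_bicyclic_coset by metis
qed

text \<open>Left regularity of \<open>emb q\<close> transfers back along the injective map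
  \<open>coset_to_bicyclic\<close>. This supplies the left regular elements used as multipliers and
  denominators.\<close>

lemma emb_lift_regular:
  assumes "q \<in> polys_in n" "q \<noteq> 0"
  obtains P where "P \<in> left_regular_elements R" "coset_to_bicyclic P = emb q"
proof -
  obtain P where P: "P \<in> carrier R" "coset_to_bicyclic P = emb q"
    using assms(1) by (rule emb_lift)
  have "Q = \<zero>\<^bsub>R\<^esub>" if Q: "Q \<in> carrier R" "Q \<otimes>\<^bsub>R\<^esub> P = \<zero>\<^bsub>R\<^esub>" for Q
  proof -
    have "coset_to_bicyclic Q * emb q = coset_to_bicyclic (Q \<otimes>\<^bsub>R\<^esub> P)"
      unfolding coset_to_bicyclic_mult[OF Q(1) P(1)] P(2) ..
    also have "\<dots> = 0" unfolding Q(2) by (rule coset_to_bicyclic_zero)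
    finally show ?thesis
      using mult_emb_eq_zero assms(2) coset_to_bicyclic_eq_zero Q(1) by blast
  qed
  then have "P \<in> left_regular_elements R"
    unfolding left_regular_elements_def using P(1) by blast
  then show thesis using that P(2) by blast
qed

end

section \<open>The quotient ring as the field of rational functions\<close>

lemma rational_function_field_simps:
  "carrier (rational_function_field TYPE('k::field) n) = rational_functions_in n"
  "\<one>\<^bsub>rational_function_field TYPE('k) n\<^esub> = 1"
  "f \<otimes>\<^bsub>rational_function_field TYPE('k) n\<^esub> g = f * g"
  "f \<oplus>\<^bsub>rational_function_field TYPE('k) n\<^esub> g = f + g"
  "k \<odot>\<^bsub>rational_function_field TYPE('k) n\<^esub> f = Fract (Poly_Mapping.single 0 k) 1 * f"
  by (simp_all add: rational_function_field_def rational_functions_in_def ring.defs module.defs)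

theorem corollary3p13:
  fixes n :: nat
  assumes "n \<ge> 1"
  shows "left_denominator_set (one_sided_inverse_algebra TYPE('k::field) n)
           (left_regular_elements (one_sided_inverse_algebra TYPE('k) n)) \<and>
         left_regular_elements (one_sided_inverse_algebra TYPE('k) n) =
           largest_left_regular_denominator_set (one_sided_inverse_algebra TYPE('k) n) \<and>
         classical_left_regular_left_quotient_ring (one_sided_inverse_algebra TYPE('k) n) =
           left_regular_left_quotient_ring (one_sided_inverse_algebra TYPE('k) n) \<and>
         algebra_isomorphic
           (left_regular_left_quotient_ring (one_sided_inverse_algebra TYPE('k) n))
           (rational_function_field TYPE('k) n)"
proof -
  let ?R = "one_sided_inverse_algebra TYPE('k) n" and ?L = "rational_function_field TYPE('k) n"
  let ?C = "left_regular_elements ?R"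
  let ?\<phi> = "\<lambda>P :: (gen_word \<Rightarrow>\<^sub>0 'k) set. bicyclic_fract (coset_to_bicyclic P)"
  have image: "?\<phi> P \<in> rational_functions_in n" if "P \<in> carrier ?R" for P
    using that by (intro bicyclic_fract_in_rational_functions keys_free_to_bicyclic)
  have regular_carrier: "P \<in> carrier ?R" if "P \<in> ?C" for P
    using that by (simp add: left_regular_elements_def)
  interpret R: ring ?R by (rule ring_one_sided_inverse)
  interpret left_regular_fractions ?R ?\<phi> "\<lambda>k. Fract (Poly_Mapping.single 0 k) 1"
  proof
    fix P Q assume PQ: "P \<in> carrier ?R" "Q \<in> carrier ?R"
    show "?\<phi> (P \<otimes>\<^bsub>?R\<^esub> Q) = ?\<phi> P * ?\<phi> Q" "?\<phi> (P \<oplus>\<^bsub>?R\<^esub> Q) = ?\<phi> P + ?\<phi> Q"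
      by (simp_all only: coset_to_bicyclic_mult[OF PQ] coset_to_bicyclic_add[OF PQ] bicyclic_fract_mult bicyclic_fract_add)
  next
    show "?\<phi> \<one>\<^bsub>?R\<^esub> = 1"
      by (simp only: coset_to_bicyclic_one bicyclic_fract_one)
  next
    fix P k assume "P \<in> carrier ?R"
    then obtain p where p: "p \<in> carrier (free_algebra n)"
        "P = one_sided_inverse_ideal n +>\<^bsub>free_algebra n\<^esub> p"
      by (rule one_sided_inverse_carrierE)
    let ?kp = "Poly_Mapping.single 0 k * p"
    have kp: "?kp \<in> carrier (free_algebra n)"
      using p(1) by (intro mult_in_free_algebra single_in_free_algebra words_in_zero)
    have kP: "k \<odot>\<^bsub>?R\<^esub> P = one_sided_inverse_ideal n +>\<^bsub>free_algebra n\<^esub> ?kp"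
      unfolding p(2) using p(1) by (rule smult_coset)
    show "k \<odot>\<^bsub>?R\<^esub> P \<in> carrier ?R"
      unfolding kP using kp by (rule one_sided_inverse_carrierI)
    have "push bic_word ?kp = Poly_Mapping.single 0 k * push bic_word p"
      by (simp add: push_mult bic_word_zero bic_word_add)
    then show "?\<phi> (k \<odot>\<^bsub>?R\<^esub> P) = Fract (Poly_Mapping.single 0 k) 1 * ?\<phi> P"
      unfolding p(2) smult_coset[OF p(1)] coset_to_bicyclic_coset[OF kp] coset_to_bicyclic_coset[OF p(1)]
      by (simp only: bicyclic_fract_scale)
  next
    fix P assume P: "P \<in> carrier ?R" "?\<phi> P = 0"
    \<comment> \<open>A left regular monomial carries \<open>P\<close> into the polynomials, where
      the map to the fraction field is injective; hence it kills \<open>P\<close>.\<close>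
    obtain m p where m: "m \<in> exponents_in n"
        "emb (Poly_Mapping.single m 1) * coset_to_bicyclic P = emb p"
      using monomial_clears_x[OF keys_free_to_bicyclic[OF P(1)]] by blast
    then have "Fract p 1 = 0"
      using P(2) bicyclic_fract_mult[of "emb (Poly_Mapping.single m 1)" "coset_to_bicyclic P"] by (simp add: bicyclic_fract_emb)
    then have "p = 0"
      by (simp add: Zero_fract_def eq_fract)
    obtain T where T: "T \<in> ?C" "coset_to_bicyclic T = emb (Poly_Mapping.single m 1)"
      by (rule emb_lift_regular[OF polys_in_single[OF m(1)] single_one_nonzero])
    have "coset_to_bicyclic (T \<otimes>\<^bsub>?R\<^esub> P) = 0"
      unfolding coset_to_bicyclic_mult[OF regular_carrier[OF T(1)] P(1)] T(2) m(2) \<open>p = 0\<close> by simp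
    then have "T \<otimes>\<^bsub>?R\<^esub> P = \<zero>\<^bsub>?R\<^esub>"
      using coset_to_bicyclic_eq_zero R.m_closed regular_carrier[OF T(1)] P(1) by blast
    then show "\<exists>T\<in>?C. T \<otimes>\<^bsub>?R\<^esub> P = \<zero>\<^bsub>?R\<^esub>"
      using T(1) by blast
  next
    fix P Q assume PQ: "P \<in> carrier ?R" "Q \<in> carrier ?R" "?\<phi> Q \<noteq> 0"
    obtain p q where p: "p \<in> polys_in n" "q \<in> polys_in n" "q \<noteq> 0" "?\<phi> P = Fract p q"
      using image[OF PQ(1)] by (rule rational_functions_inE)
    obtain p' q' where q: "p' \<in> polys_in n" "q' \<in> polys_in n" "q' \<noteq> 0" "?\<phi> Q = Fract p' q'"
      using image[OF PQ(2)] by (rule rational_functions_inE)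
    have "p' \<noteq> 0"
      using PQ(3) q by (auto simp: Zero_fract_def eq_fract)
    \<comment> \<open>Cross-multiplication: with images \<open>p / q\<close> of \<open>P\<close> and
      \<open>p' / q'\<close> of \<open>Q\<close>, the multipliers \<open>p' * q\<close> and
      \<open>p * q'\<close> both lead to \<open>p * p'\<close>. The former is nonzero, hence lifts
      to a left regular element.\<close>
    obtain T where T: "T \<in> ?C" "coset_to_bicyclic T = emb (p' * q)"
      by (rule emb_lift_regular[of "p' * q" n]) (use p q \<open>p' \<noteq> 0\<close> in auto)
    obtain A where A: "A \<in> carrier ?R" "coset_to_bicyclic A = emb (p * q')"
      by (rule emb_lift[of "p * q'" n]) (use p q in auto)
    have "?\<phi> T * ?\<phi> P = ?\<phi> A * ?\<phi> Q"
      unfolding T(2) A(2) p(4) q(4) bicyclic_fract_emb using p(3) q(3) by (simp add: eq_fract)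
    then show "\<exists>T\<in>?C. \<exists>A\<in>carrier ?R. ?\<phi> T * ?\<phi> P = ?\<phi> A * ?\<phi> Q"
      using T(1) A(1) by blast
  qed
  \<comment> \<open>Images of \<open>?R\<close> are rational functions, and a quotient of
    polynomials is reached by lifting numerator and denominator separately.\<close>
  have "fractions = rational_functions_in n"
  proof (intro equalityI subsetI)
    fix f assume "f \<in> fractions"
    then obtain P Q where "P \<in> carrier ?R" "Q \<in> ?C" "f = ?\<phi> P / ?\<phi> Q"
      by (rule fractionsE)
    then show "f \<in> rational_functions_in n"
      using rational_functions_in_divide[OF image image] hom_C_nonzero regular_carrier by blast
  next
    fix f :: "((nat \<Rightarrow>\<^sub>0 nat) \<Rightarrow>\<^sub>0 'k) fract" assume "f \<in> rational_functions_in n"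
    then obtain p q where p: "p \<in> polys_in n" "q \<in> polys_in n" "q \<noteq> 0" "f = Fract p q"
      by (rule rational_functions_inE)
    obtain P where P: "P \<in> carrier ?R" "coset_to_bicyclic P = emb p"
      using p(1) by (rule emb_lift)
    obtain Q where Q: "Q \<in> ?C" "coset_to_bicyclic Q = emb q"
      using p(2,3) by (rule emb_lift_regular)
    have "f = ?\<phi> P / ?\<phi> Q"
      unfolding P(2) Q(2) bicyclic_fract_emb p(4) by simp
    then show "f \<in> fractions"
      using fractionsI[OF P(1) Q(1)] by simp
  qed
  then have "algebra_isomorphic (left_localization ?R ?C) ?L"
    by (intro algebra_isomorphic_fractions)
      (simp_all add: rational_function_field_simps rational_functions_in_add rational_functions_in_mult)
  then show ?thesis
    unfolding classical_left_regular_left_quotient_ring_def left_regular_left_quotient_ring_def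
      largest_eq_C
    using left_denominator_set_C by blast
qed

end
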